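(* Let $\mathcal{T}$ be a $k$-linear, Hom-finite, Krull-Schmidt triangulated category admitting a minimal linear generator $G=\bigoplus_{i=1}^m G_i$ with $m$ indecomposable summands. Then the graded endomorphism algebra $\mathrm{End}^{\ast}_{\mathcal{T}}(G)$ is isomorphic to the upper triangular $m\times m$-matrix algebra $\chi^G$, with \[ \chi^G_{i,j}:=\begin{cases} k[x] & \text{if } i=j \text{ and } G_i<G_i[1],\\ 0 & \text{if } j<i,\\ k[x^{\pm}] & \text{otherwise,}\end{cases}\] where $x$ is concentrated in degree $-1$.
   Context: $k$ is an algebraically closed field. For a triangulated category $\mathcal{T}$ with suspension $[1]$, write $\mathcal{T}(X,Y)$ for the space of morphisms $X\to Y$. For $X\in\mathcal{T}$: $\langle X\rangle$ is the smallest thick subcategory containing $X$; $\langle X\rangle_1$ is the smallest additive full subcategory of $\mathcal{T}$ which contains $X$ and is closed under direct summands and the suspension functor $[1]$. $G$ is a classical generator if $\langle G\rangle=\mathcal{T}$. A linear generator is a classical generator $G$ such that: (G1) the set of isomorphism classes of indecomposable objects in $\langle G\rangle_1$ admits a total ordering defined by: $Q\le P$ if and only if $\mathcal{T}(P,Q)\cong k$; moreover, if $Q\le P$ and $Q\not\cong P$, then $\mathcal{T}(Q,P)=0$; (G2) $P\le P[1]$ for each indecomposable $P\in\langle G\rangle_1$; (G3) for indecomposables $P,Q\in\langle G\rangle_1$, $P\le Q\le P[1]$ implies that $Q$ is isomorphic to at least one of $P$ and $P[1]$; (G4) for indecomposables $R\le Q\le P$ in $\langle G\rangle_1$, any morphism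 from $P$ to $R$ factors non-trivially through $Q$. We write $Q<P$ if $Q\le P$ and $Q\not\cong P$. A generator $G$ is minimal if there is no proper direct summand $H$ of $G$ such that $H$ is a (classical) generator of $\mathcal{T}$. The graded endomorphism algebra $\mathrm{End}^\ast_{\mathcal{T}}(Y)$ has degree $i$ part $\mathcal{T}(Y,Y[i])$ ($i\in\mathbb{Z}$), with product $g\cdot f:=g[i]\circ f$ for $f$ of degree $i$. The multiplication of $\chi^G$ is matrix multiplication, with products of entries taken in $k[x^{\pm}]\supseteq k[x]$. *)

theory Defs
  imports "Jordan_Normal_Form.VS_Connect" "HOL-Library.Poly_Mapping" "HOL-Algebra.QuotRing"
begin

section \<open>Triangulated categories over a field\<close>

text \<open>
  Objects form a type; every Hom set is the carrier of a module record, so it carries its own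
  zero, addition and scalar multiplication (the ring multiplication slots of that record are not
  used).  Composition \<open>g \<cdot> f\<close> does not mention objects, which is no restriction, since Hom sets can
  always be made disjoint.  The suspension functor is an automorphism \<open>[1]\<close>, given together with all its integer
  powers: \<open>shift T n\<close> and \<open>shift_map T n\<close> are the actions of \<open>[n]\<close> on objects and morphisms.
  A triangle \<open>X \<rightarrow> Y \<rightarrow> Z \<rightarrow> X[1]\<close> with maps \<open>u, v, w\<close> is the tuple \<open>(X, Y, Z, u, v, w)\<close>.
\<close>

record ('k, 'o, 'm) tricat =
  Hom :: "'o \<Rightarrow> 'o \<Rightarrow> ('k, 'm) module"
  cmp :: "'m \<Rightarrow> 'm \<Rightarrow> 'm"  (infixl \<open>\<cdot>\<index>\<close> 70)
  ident :: "'o \<Rightarrow> 'm"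
  shift :: "int \<Rightarrow> 'o \<Rightarrow> 'o"
  shift_map :: "int \<Rightarrow> 'm \<Rightarrow> 'm"
  dist_tri :: "('o \<times> 'o \<times> 'o \<times> 'm \<times> 'm \<times> 'm) set"

abbreviation Mor :: "('k, 'o, 'm) tricat \<Rightarrow> 'o \<Rightarrow> 'o \<Rightarrow> 'm set"
  where "Mor T X Y \<equiv> carrier (Hom T X Y)"

definition is_iso :: "('k, 'o, 'm) tricat \<Rightarrow> 'o \<Rightarrow> 'o \<Rightarrow> 'm \<Rightarrow> bool"
  where "is_iso T X Y f \<longleftrightarrow> f \<in> Mor T X Y \<and>
    (\<exists>g \<in> Mor T Y X. g \<cdot>\<^bsub>T\<^esub> f = ident T X \<and> f \<cdot>\<^bsub>T\<^esub> g = ident T Y)"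

definition isomorphic :: "('k, 'o, 'm) tricat \<Rightarrow> 'o \<Rightarrow> 'o \<Rightarrow> bool"
  where "isomorphic T X Y \<longleftrightarrow> (\<exists>f. is_iso T X Y f)"

definition zero_object :: "('k, 'o, 'm) tricat \<Rightarrow> 'o \<Rightarrow> bool"
  where "zero_object T Z \<longleftrightarrow>
    (\<forall>X. Mor T X Z = {\<zero>\<^bsub>Hom T X Z\<^esub>} \<and> Mor T Z X = {\<zero>\<^bsub>Hom T Z X\<^esub>})"

text \<open>\<open>X\<close> is a direct sum (biproduct) of the objects in the list \<open>Xs\<close>.\<close>

definition is_direct_sum :: "('k, 'o, 'm) tricat \<Rightarrow> 'o \<Rightarrow> 'o list \<Rightarrow> bool"
  where "is_direct_sum T X Xs \<longleftrightarrow> (\<exists>inc prj.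
    (\<forall>i < length Xs. inc i \<in> Mor T (Xs ! i) X \<and> prj i \<in> Mor T X (Xs ! i)) \<and>
    (\<forall>i < length Xs. \<forall>j < length Xs. prj i \<cdot>\<^bsub>T\<^esub> inc j =
       (if i = j then ident T (Xs ! i) else \<zero>\<^bsub>Hom T (Xs ! j) (Xs ! i)\<^esub>)) \<and>
    finsum (Hom T X X) (\<lambda>i. inc i \<cdot>\<^bsub>T\<^esub> prj i) {..<length Xs} = ident T X)"

locale linear_category =
  fixes T :: "('k :: field, 'o, 'm) tricat" (structure)
  assumes Hom_vectorspace: "vectorspace class_ring (Hom T X Y)"
    and cmp_closed: "\<lbrakk>f \<in> Mor T X Y; g \<in> Mor T Y Z\<rbrakk> \<Longrightarrow> g \<cdot> f \<in> Mor T X Z"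
    and cmp_assoc: "\<lbrakk>f \<in> Mor T W X; g \<in> Mor T X Y; h \<in> Mor T Y Z\<rbrakk> \<Longrightarrow> h \<cdot> (g \<cdot> f) = (h \<cdot> g) \<cdot> f"
    and ident_closed: "ident T X \<in> Mor T X X"
    and cmp_ident_right: "f \<in> Mor T X Y \<Longrightarrow> f \<cdot> ident T X = f"
    and cmp_ident_left: "f \<in> Mor T X Y \<Longrightarrow> ident T Y \<cdot> f = f"
    and cmp_add_right: "\<lbrakk>f \<in> Mor T X Y; f' \<in> Mor T X Y; g \<in> Mor T Y Z\<rbrakk> \<Longrightarrow>
      g \<cdot> (f \<oplus>\<^bsub>Hom T X Y\<^esub> f') = (g \<cdot> f) \<oplus>\<^bsub>Hom T X Z\<^esub> (g \<cdot> f')"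
    and cmp_add_left: "\<lbrakk>f \<in> Mor T X Y; g \<in> Mor T Y Z; g' \<in> Mor T Y Z\<rbrakk> \<Longrightarrow>
      (g \<oplus>\<^bsub>Hom T Y Z\<^esub> g') \<cdot> f = (g \<cdot> f) \<oplus>\<^bsub>Hom T X Z\<^esub> (g' \<cdot> f)"
    and cmp_smult_right: "\<lbrakk>f \<in> Mor T X Y; g \<in> Mor T Y Z\<rbrakk> \<Longrightarrow>
      g \<cdot> (c \<odot>\<^bsub>Hom T X Y\<^esub> f) = c \<odot>\<^bsub>Hom T X Z\<^esub> (g \<cdot> f)"
    and cmp_smult_left: "\<lbrakk>f \<in> Mor T X Y; g \<in> Mor T Y Z\<rbrakk> \<Longrightarrow>
      (c \<odot>\<^bsub>Hom T Y Z\<^esub> g) \<cdot> f = c \<odot>\<^bsub>Hom T X Z\<^esub> (g \<cdot> f)"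

locale triangulated_category = linear_category +
  assumes zero_object_exists: "\<exists>Z. zero_object T Z"
    and direct_sum_exists: "\<exists>S. is_direct_sum T S [X, Y]"
    and shift_map_closed: "f \<in> Mor T X Y \<Longrightarrow> shift_map T n f \<in> Mor T (shift T n X) (shift T n Y)"
    and shift_zero: "shift T 0 X = X"
    and shift_map_zero: "f \<in> Mor T X Y \<Longrightarrow> shift_map T 0 f = f"
    and shift_shift: "shift T a (shift T b X) = shift T (a + b) X"
    and shift_map_shift_map: "f \<in> Mor T X Y \<Longrightarrow> shift_map T a (shift_map T b f) = shift_map T (a + b) f"
    and shift_map_ident: "shift_map T n (ident T X) = ident T (shift T n X)"
    and shift_map_cmp: "\<lbrakk>f \<in> Mor T X Y; g \<in> Mor T Y Z\<rbrakk> \<Longrightarrow>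
      shift_map T n (g \<cdot> f) = shift_map T n g \<cdot> shift_map T n f"
    and shift_map_add: "\<lbrakk>f \<in> Mor T X Y; f' \<in> Mor T X Y\<rbrakk> \<Longrightarrow>
      shift_map T n (f \<oplus>\<^bsub>Hom T X Y\<^esub> f') =
        shift_map T n f \<oplus>\<^bsub>Hom T (shift T n X) (shift T n Y)\<^esub> shift_map T n f'"
    and shift_map_smult: "f \<in> Mor T X Y \<Longrightarrow>
      shift_map T n (c \<odot>\<^bsub>Hom T X Y\<^esub> f) = c \<odot>\<^bsub>Hom T (shift T n X) (shift T n Y)\<^esub> shift_map T n f"
    and dist_Mor: "(X, Y, Z, u, v, w) \<in> dist_tri T \<Longrightarrow>
      u \<in> Mor T X Y \<and> v \<in> Mor T Y Z \<and> w \<in> Mor T Z (shift T 1 X)"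
    and TR1_ident: "zero_object T Z \<Longrightarrow>
      (X, X, Z, ident T X, \<zero>\<^bsub>Hom T X Z\<^esub>, \<zero>\<^bsub>Hom T Z (shift T 1 X)\<^esub>) \<in> dist_tri T"
    and TR1_iso: "\<lbrakk>(X, Y, Z, u, v, w) \<in> dist_tri T;
      u' \<in> Mor T X' Y'; v' \<in> Mor T Y' Z'; w' \<in> Mor T Z' (shift T 1 X');
      is_iso T X X' f; is_iso T Y Y' g; is_iso T Z Z' h;
      g \<cdot> u = u' \<cdot> f; h \<cdot> v = v' \<cdot> g; shift_map T 1 f \<cdot> w = w' \<cdot> h\<rbrakk> \<Longrightarrow>
      (X', Y', Z', u', v', w') \<in> dist_tri T"
    and TR1_cone: "u \<in> Mor T X Y \<Longrightarrow> \<exists>Z v w. (X, Y, Z, u, v, w) \<in> dist_tri T"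
    and TR2: "\<lbrakk>u \<in> Mor T X Y; v \<in> Mor T Y Z; w \<in> Mor T Z (shift T 1 X)\<rbrakk> \<Longrightarrow>
      (X, Y, Z, u, v, w) \<in> dist_tri T \<longleftrightarrow>
      (Y, Z, shift T 1 X, v, w, \<ominus>\<^bsub>Hom T (shift T 1 X) (shift T 1 Y)\<^esub> (shift_map T 1 u)) \<in> dist_tri T"
    and TR3: "\<lbrakk>(X, Y, Z, u, v, w) \<in> dist_tri T; (X', Y', Z', u', v', w') \<in> dist_tri T;
      f \<in> Mor T X X'; g \<in> Mor T Y Y'; g \<cdot> u = u' \<cdot> f\<rbrakk> \<Longrightarrow>
      \<exists>h \<in> Mor T Z Z'. h \<cdot> v = v' \<cdot> g \<and> shift_map T 1 f \<cdot> w = w' \<cdot> h"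
    and TR4: "\<lbrakk>(X, Y, Z', u, i, i') \<in> dist_tri T; (Y, Z, X', v, j, j') \<in> dist_tri T;
      (X, Z, Y', v \<cdot> u, l, l') \<in> dist_tri T\<rbrakk> \<Longrightarrow>
      \<exists>f g. (Z', Y', X', f, g, shift_map T 1 i \<cdot> j') \<in> dist_tri T \<and>
        f \<cdot> i = l \<cdot> v \<and> l' \<cdot> f = i' \<and> g \<cdot> l = j \<and> j' \<cdot> g = shift_map T 1 u \<cdot> l'"

definition hom_finite :: "('k :: field, 'o, 'm) tricat \<Rightarrow> bool"
  where "hom_finite T \<longleftrightarrow> (\<forall>X Y. vectorspace.fin_dim class_ring (Hom T X Y))"

text \<open>The endomorphism ring of \<open>X\<close> is local: it is nonzero and its non-units are closed under
  addition.\<close>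

definition local_End :: "('k, 'o, 'm) tricat \<Rightarrow> 'o \<Rightarrow> bool"
  where "local_End T X \<longleftrightarrow> ident T X \<noteq> \<zero>\<^bsub>Hom T X X\<^esub> \<and>
    (\<forall>f \<in> Mor T X X. \<forall>g \<in> Mor T X X. \<not> is_iso T X X f \<and> \<not> is_iso T X X g \<longrightarrow>
       \<not> is_iso T X X (f \<oplus>\<^bsub>Hom T X X\<^esub> g))"

definition krull_schmidt :: "('k, 'o, 'm) tricat \<Rightarrow> bool"
  where "krull_schmidt T \<longleftrightarrow> (\<forall>X. \<exists>Xs. is_direct_sum T X Xs \<and> (\<forall>Y \<in> set Xs. local_End T Y))"

definition indecomposable :: "('k, 'o, 'm) tricat \<Rightarrow> 'o \<Rightarrow> bool"
  where "indecomposable T X \<longleftrightarrow> \<not> zero_object T X \<and>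
    (\<forall>A B. is_direct_sum T X [A, B] \<longrightarrow> zero_object T A \<or> zero_object T B)"


section \<open>Generators\<close>

text \<open>Full subcategories are identified with their sets of objects.  Closure under isomorphism
  follows from closure under direct summands, since \<open>X\<close> is a direct sum of \<open>Y\<close> and a zero object
  whenever \<open>X\<close> and \<open>Y\<close> are isomorphic.\<close>

definition additive_summand_closed :: "('k, 'o, 'm) tricat \<Rightarrow> 'o set \<Rightarrow> bool"
  where "additive_summand_closed T \<S> \<longleftrightarrow>
    (\<forall>Z. zero_object T Z \<longrightarrow> Z \<in> \<S>) \<and>
    (\<forall>X A B. is_direct_sum T X [A, B] \<longrightarrow> (X \<in> \<S> \<longleftrightarrow> A \<in> \<S> \<and> B \<in> \<S>))"

definition thick_subcategory :: "('k, 'o, 'm) tricat \<Rightarrow> 'o set \<Rightarrow> bool"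
  where "thick_subcategory T \<S> \<longleftrightarrow> additive_summand_closed T \<S> \<and>
    (\<forall>X \<in> \<S>. \<forall>n. shift T n X \<in> \<S>) \<and>
    (\<forall>X Y Z u v w. (X, Y, Z, u, v, w) \<in> dist_tri T \<and> X \<in> \<S> \<and> Y \<in> \<S> \<longrightarrow> Z \<in> \<S>)"

definition thick_closure :: "('k, 'o, 'm) tricat \<Rightarrow> 'o \<Rightarrow> 'o set"
  where "thick_closure T G = \<Inter> {\<S>. thick_subcategory T \<S> \<and> G \<in> \<S>}"

definition thick_closure1 :: "('k, 'o, 'm) tricat \<Rightarrow> 'o \<Rightarrow> 'o set"
  where "thick_closure1 T G =
    \<Inter> {\<S>. additive_summand_closed T \<S> \<and> (\<forall>X \<in> \<S>. shift T 1 X \<in> \<S>) \<and> G \<in> \<S>}"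

definition classical_generator :: "('k, 'o, 'm) tricat \<Rightarrow> 'o \<Rightarrow> bool"
  where "classical_generator T G \<longleftrightarrow> thick_closure T G = UNIV"

definition indec1 :: "('k, 'o, 'm) tricat \<Rightarrow> 'o \<Rightarrow> 'o set"
  where "indec1 T G = {P \<in> thick_closure1 T G. indecomposable T P}"

definition iso_rel :: "('k, 'o, 'm) tricat \<Rightarrow> 'o set \<Rightarrow> ('o \<times> 'o) set"
  where "iso_rel T A = {(P, Q). P \<in> A \<and> Q \<in> A \<and> isomorphic T P Q}"

text \<open>\<open>V\<close> is isomorphic, as a vector space, to the ground field.\<close>

definition iso_ground_field :: "('k :: field, 'm) module \<Rightarrow> bool"
  where "iso_ground_field V \<longleftrightarrow> (\<exists>\<phi> :: 'k \<Rightarrow> 'm. bij_betw \<phi> UNIV (carrier V) \<and>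
    (\<forall>a b. \<phi> (a + b) = \<phi> a \<oplus>\<^bsub>V\<^esub> \<phi> b) \<and> (\<forall>a b. \<phi> (a * b) = a \<odot>\<^bsub>V\<^esub> \<phi> b))"

definition obj_le :: "('k :: field, 'o, 'm) tricat \<Rightarrow> 'o \<Rightarrow> 'o \<Rightarrow> bool"
  where "obj_le T Q P \<longleftrightarrow> iso_ground_field (Hom T P Q)"

definition obj_less :: "('k :: field, 'o, 'm) tricat \<Rightarrow> 'o \<Rightarrow> 'o \<Rightarrow> bool"
  where "obj_less T Q P \<longleftrightarrow> obj_le T Q P \<and> \<not> isomorphic T Q P"

text \<open>A factorization is non-trivial if both factors are nonzero.  It is required of nonzero
  morphisms only: since all Hom spaces along \<open>R \<le> Q \<le> P\<close> are one-dimensional, factoring a nonzero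
  morphism \<open>P \<rightarrow> R\<close> through \<open>Q\<close> makes every composite of nonzero morphisms \<open>P \<rightarrow> Q \<rightarrow> R\<close> nonzero, so
  the zero morphism has no non-trivial factorization.\<close>

definition linear_generator :: "('k :: field, 'o, 'm) tricat \<Rightarrow> 'o \<Rightarrow> bool"
  where "linear_generator T G \<longleftrightarrow> classical_generator T G \<and>
    (let I = indec1 T G; E = iso_rel T I in
     linear_order_on (I // E) {(E `` {Q}, E `` {P}) | Q P. Q \<in> I \<and> P \<in> I \<and> obj_le T Q P} \<and>
     (\<forall>P \<in> I. \<forall>Q \<in> I. obj_le T Q P \<and> \<not> isomorphic T Q P \<longrightarrow> Mor T Q P = {\<zero>\<^bsub>Hom T Q P\<^esub>}) \<and>
     (\<forall>P \<in> I. obj_le T P (shift T 1 P)) \<and>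
     (\<forall>P \<in> I. \<forall>Q \<in> I. obj_le T P Q \<and> obj_le T Q (shift T 1 P) \<longrightarrow>
        isomorphic T Q P \<or> isomorphic T Q (shift T 1 P)) \<and>
     (\<forall>P \<in> I. \<forall>Q \<in> I. \<forall>R \<in> I. obj_le T R Q \<and> obj_le T Q P \<longrightarrow>
        (\<forall>h \<in> Mor T P R. h \<noteq> \<zero>\<^bsub>Hom T P R\<^esub> \<longrightarrow>
           (\<exists>f \<in> Mor T P Q. \<exists>g \<in> Mor T Q R.
              f \<noteq> \<zero>\<^bsub>Hom T P Q\<^esub> \<and> g \<noteq> \<zero>\<^bsub>Hom T Q R\<^esub> \<and> h = g \<cdot>\<^bsub>T\<^esub> f))))"

text \<open>A direct summand is proper if its complement is nonzero.\<close>

definition minimal_generator :: "('k, 'o, 'm) tricat \<Rightarrow> 'o \<Rightarrow> bool"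
  where "minimal_generator T G \<longleftrightarrow> classical_generator T G \<and>
    \<not> (\<exists>H H'. is_direct_sum T G [H, H'] \<and> \<not> zero_object T H' \<and> classical_generator T H)"


section \<open>Graded algebras\<close>

record ('k, 'a) graded_algebra = "('k, 'a) module" +
  component :: "int \<Rightarrow> 'a set"

definition graded_algebra_iso ::
    "('k, 'a) graded_algebra \<Rightarrow> ('k, 'b) graded_algebra \<Rightarrow> ('a \<Rightarrow> 'b) \<Rightarrow> bool"
  where "graded_algebra_iso A B \<phi> \<longleftrightarrow> \<phi> \<in> ring_iso A B \<and>
    (\<forall>c. \<forall>a \<in> carrier A. \<phi> (c \<odot>\<^bsub>A\<^esub> a) = c \<odot>\<^bsub>B\<^esub> \<phi> a) \<and>
    (\<forall>d. \<phi> ` component A d = component B d)"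

text \<open>Elements of the direct sum of the spaces of morphisms \<open>Y \<rightarrow> Y[i]\<close> are families indexed by
  \<open>i\<close> with finite support.\<close>

definition graded_End_carrier :: "('k, 'o, 'm) tricat \<Rightarrow> 'o \<Rightarrow> (int \<Rightarrow> 'm) set"
  where "graded_End_carrier T Y = {f. (\<forall>i. f i \<in> Mor T Y (shift T i Y)) \<and>
    finite {i. f i \<noteq> \<zero>\<^bsub>Hom T Y (shift T i Y)\<^esub>}}"

definition graded_End :: "('k, 'o, 'm) tricat \<Rightarrow> 'o \<Rightarrow> ('k, int \<Rightarrow> 'm) graded_algebra"
  where "graded_End T Y = \<lparr>
    carrier = graded_End_carrier T Y,
    monoid.mult = (\<lambda>g f n. finsum (Hom T Y (shift T n Y))
      (\<lambda>i. shift_map T i (g (n - i)) \<cdot>\<^bsub>T\<^esub> f i)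
      {i. f i \<noteq> \<zero>\<^bsub>Hom T Y (shift T i Y)\<^esub>}),
    one = (\<lambda>i. if i = 0 then ident T Y else \<zero>\<^bsub>Hom T Y (shift T i Y)\<^esub>),
    ring.zero = (\<lambda>i. \<zero>\<^bsub>Hom T Y (shift T i Y)\<^esub>),
    add = (\<lambda>f g i. f i \<oplus>\<^bsub>Hom T Y (shift T i Y)\<^esub> g i),
    module.smult = (\<lambda>c f i. c \<odot>\<^bsub>Hom T Y (shift T i Y)\<^esub> f i),
    component = (\<lambda>d. {f \<in> graded_End_carrier T Y.
      \<forall>i. i \<noteq> d \<longrightarrow> f i = \<zero>\<^bsub>Hom T Y (shift T i Y)\<^esub>})\<rparr>"

text \<open>Laurent polynomials over \<open>'k\<close> in \<open>x\<close> are the finitely supported maps from the exponents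
  to \<open>'k\<close> with the convolution product; \<open>x\<close> is \<open>Poly_Mapping.single 1 1\<close>.\<close>

type_synonym 'k laurent = "int \<Rightarrow>\<^sub>0 'k"

definition polys :: "'k :: zero laurent set"
  where "polys = {p. Poly_Mapping.keys p \<subseteq> {0..}}"

text \<open>Matrix indices start at 0.\<close>

definition chi_entry :: "('k :: field, 'o, 'm) tricat \<Rightarrow> 'o list \<Rightarrow> nat \<Rightarrow> nat \<Rightarrow> 'k laurent set"
  where "chi_entry T Gs i j =
    (if i = j \<and> obj_less T (Gs ! i) (shift T 1 (Gs ! i)) then polys
     else if j < i then {0}
     else UNIV)"

definition chi_carrier :: "('k :: field, 'o, 'm) tricat \<Rightarrow> 'o list \<Rightarrow> 'k laurent mat set"
  where "chi_carrier T Gs = {A \<in> carrier_mat (length Gs) (length Gs).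
    \<forall>i < length Gs. \<forall>j < length Gs. A $$ (i, j) \<in> chi_entry T Gs i j}"

text \<open>As \<open>x\<close> has degree \<open>-1\<close>, the component of degree \<open>d\<close> consists of the matrices all of whose
  entries are scalar multiples of the power of \<open>x\<close> with exponent \<open>-d\<close>.\<close>

definition chi :: "('k :: field, 'o, 'm) tricat \<Rightarrow> 'o list \<Rightarrow> ('k, 'k laurent mat) graded_algebra"
  where "chi T Gs = \<lparr>
    carrier = chi_carrier T Gs,
    monoid.mult = (*),
    one = 1\<^sub>m (length Gs),
    ring.zero = 0\<^sub>m (length Gs) (length Gs),
    add = (+),
    module.smult = (\<lambda>c A. Poly_Mapping.single 0 c \<cdot>\<^sub>m A),
    component = (\<lambda>d. {A \<in> chi_carrier T Gs.
      \<forall>i < length Gs. \<forall>j < length Gs. Poly_Mapping.keys (A $$ (i, j)) \<subseteq> {- d}})\<rparr>"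

end

theory Submission
  imports Defs
begin

text \<open>
  Let \<open>J\<close> be the class of all shifts of indecomposable objects of \<open>\<langle>G\<rangle>\<^sub>1\<close>.  By the axioms of a linear generator,
  the space of morphisms \<open>P \<rightarrow> Q\<close> between two objects of \<open>J\<close> is one-dimensional if \<open>Q \<le> P\<close> and zero
  otherwise, and composites of nonzero morphisms within \<open>J\<close> are nonzero, because a nonzero morphism
  \<open>P \<rightarrow> R\<close> factors through every \<open>Q\<close> in between
  (\<open>linear_generator_linearly_ordered_objects\<close>).

  Minimality means that no summand is a shift of another one (\<open>minimal_generator_summands\<close>).  As
  nothing lies strictly between \<open>P\<close> and \<open>P[1]\<close>, it follows that for summands \<open>P < Q\<close> all shifts of
  \<open>P\<close> lie below all shifts of \<open>Q\<close> (\<open>obj_less_shifts\<close>).  So if the summands \<open>H\<^sub>0, H\<^sub>1, \<dots>\<close> are listed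
  in increasing order, the space of morphisms \<open>H\<^sub>j \<rightarrow> H\<^sub>l[n]\<close> is one-dimensional for all \<open>n\<close> if
  \<open>l < j\<close>, and zero if \<open>j < l\<close>; for \<open>l = j\<close> it is one-dimensional exactly if \<open>n \<le> 0\<close> or \<open>H\<^sub>l\<close> is
  isomorphic to \<open>H\<^sub>l[1]\<close> (\<open>shift_le_self_iff\<close>).  These are the dimensions of the homogeneous parts
  of the entries of \<open>\<chi>\<close>.

  It remains to choose bases that are compatible with composition.  This is done by representing
  everything on morphisms into the smallest summand \<open>H\<^sub>0\<close>: with a nonzero \<open>x : H\<^sub>0 \<rightarrow> H\<^sub>0[-1]\<close> and
  nonzero \<open>b\<^sub>X : X \<rightarrow> H\<^sub>0\<close>, the composites \<open>x\<^bsup>p\<^esup> b\<^sub>X\<close> span the spaces of morphisms \<open>X \<rightarrow> H\<^sub>0[-p]\<close>, and a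
  morphism \<open>f : X \<rightarrow> Y[q]\<close> satisfies \<open>x\<^bsup>p\<^esup> b\<^sub>Y f = c x\<^bsup>p-q\<^esup> b\<^sub>X\<close> for a scalar \<open>c\<close> that does not depend on
  \<open>p\<close>.  The assignment of \<open>c\<close> to \<open>f\<close> is linear, injective and multiplicative by construction
  (\<open>scalar_functor_exists\<close>).  Applied to the matrix entries of a graded endomorphism of \<open>G\<close>, it gives
  the isomorphism (\<open>matrix_coordinates_exist\<close>, \<open>graded_End_iso_chi\<close>).
\<close>

section \<open>Linear categories and direct sums\<close>

context linear_category
begin

lemma Hom_module: "module class_ring (Hom T X Y)"
  using Hom_vectorspace[of X Y] by (simp add: vectorspace_def)

sublocale Hom: abelian_group "Hom T X Y" for X Y
  using Hom_module[of X Y] by (simp add: Module.module_def)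

lemma smult_closed [simp]: "f \<in> Mor T X Y \<Longrightarrow> c \<odot>\<^bsub>Hom T X Y\<^esub> f \<in> Mor T X Y"
  using module.smult_closed[OF Hom_module] by simp

lemma smult_add_left:
  "f \<in> Mor T X Y \<Longrightarrow> (a + b) \<odot>\<^bsub>Hom T X Y\<^esub> f = a \<odot>\<^bsub>Hom T X Y\<^esub> f \<oplus>\<^bsub>Hom T X Y\<^esub> b \<odot>\<^bsub>Hom T X Y\<^esub> f"
  using module.smult_l_distr[OF Hom_module[of X Y], of a b f] by simp

lemma smult_smult:
  "f \<in> Mor T X Y \<Longrightarrow> a \<odot>\<^bsub>Hom T X Y\<^esub> (b \<odot>\<^bsub>Hom T X Y\<^esub> f) = (a * b) \<odot>\<^bsub>Hom T X Y\<^esub> f"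
  using module.smult_assoc1[OF Hom_module[of X Y], of a b f] by simp

lemma smult_one [simp]: "f \<in> Mor T X Y \<Longrightarrow> 1 \<odot>\<^bsub>Hom T X Y\<^esub> f = f"
  using module.smult_one[OF Hom_module[of X Y], of f] by simp

lemma smult_zero_left [simp]: "f \<in> Mor T X Y \<Longrightarrow> 0 \<odot>\<^bsub>Hom T X Y\<^esub> f = \<zero>\<^bsub>Hom T X Y\<^esub>"
  using module.smult_l_null[OF Hom_module[of X Y], of f] by simp

lemma smult_zero_right [simp]: "c \<odot>\<^bsub>Hom T X Y\<^esub> \<zero>\<^bsub>Hom T X Y\<^esub> = \<zero>\<^bsub>Hom T X Y\<^esub>"
  using module.smult_r_null[OF Hom_module[of X Y], of c] by simp

lemma smult_eq_zero_iff:
  assumes "f \<in> Mor T X Y"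
  shows "c \<odot>\<^bsub>Hom T X Y\<^esub> f = \<zero>\<^bsub>Hom T X Y\<^esub> \<longleftrightarrow> c = 0 \<or> f = \<zero>\<^bsub>Hom T X Y\<^esub>"
proof
  assume *: "c \<odot>\<^bsub>Hom T X Y\<^esub> f = \<zero>\<^bsub>Hom T X Y\<^esub>"
  show "c = 0 \<or> f = \<zero>\<^bsub>Hom T X Y\<^esub>"
  proof (cases "c = 0")
    case False
    then have "f = inverse c \<odot>\<^bsub>Hom T X Y\<^esub> (c \<odot>\<^bsub>Hom T X Y\<^esub> f)"
      using assms by (simp add: smult_smult)
    then show ?thesis using * by simp
  qed simp
qed (use assms in auto)

lemma smult_cancel:
  assumes f: "f \<in> Mor T X Y" "f \<noteq> \<zero>\<^bsub>Hom T X Y\<^esub>"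
    and eq: "a \<odot>\<^bsub>Hom T X Y\<^esub> f = b \<odot>\<^bsub>Hom T X Y\<^esub> f"
  shows "a = b"
proof -
  have "a \<odot>\<^bsub>Hom T X Y\<^esub> f = (a - b) \<odot>\<^bsub>Hom T X Y\<^esub> f \<oplus>\<^bsub>Hom T X Y\<^esub> b \<odot>\<^bsub>Hom T X Y\<^esub> f"
    using smult_add_left[OF f(1), of "a - b" b] by simp
  then have "(a - b) \<odot>\<^bsub>Hom T X Y\<^esub> f = \<zero>\<^bsub>Hom T X Y\<^esub>"
    using eq f(1) by (metis Hom.add.l_cancel_one' Hom.add.m_comm smult_closed)
  then show ?thesis using f smult_eq_zero_iff[of f X Y "a - b"] by simp
qed

lemma cmp_zero_right [simp]:
  assumes "g \<in> Mor T Y Z"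
  shows "g \<cdot> \<zero>\<^bsub>Hom T X Y\<^esub> = \<zero>\<^bsub>Hom T X Z\<^esub>"
proof -
  have "g \<cdot> (0 \<odot>\<^bsub>Hom T X Y\<^esub> \<zero>\<^bsub>Hom T X Y\<^esub>) = 0 \<odot>\<^bsub>Hom T X Z\<^esub> (g \<cdot> \<zero>\<^bsub>Hom T X Y\<^esub>)"
    by (rule cmp_smult_right) (use assms in auto)
  then show ?thesis using assms cmp_closed[of "\<zero>\<^bsub>Hom T X Y\<^esub>" X Y g Z] by simp
qed

lemma cmp_zero_left [simp]:
  assumes "f \<in> Mor T X Y"
  shows "\<zero>\<^bsub>Hom T Y Z\<^esub> \<cdot> f = \<zero>\<^bsub>Hom T X Z\<^esub>"
proof -
  have "(0 \<odot>\<^bsub>Hom T Y Z\<^esub> \<zero>\<^bsub>Hom T Y Z\<^esub>) \<cdot> f = 0 \<odot>\<^bsub>Hom T X Z\<^esub> (\<zero>\<^bsub>Hom T Y Z\<^esub> \<cdot> f)"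
    by (rule cmp_smult_left) (use assms in auto)
  then show ?thesis using assms cmp_closed[of f X Y "\<zero>\<^bsub>Hom T Y Z\<^esub>" Z] by simp
qed

lemma cmp_finsum_right:
  assumes "finite A" "\<And>i. i \<in> A \<Longrightarrow> f i \<in> Mor T X Y" "g \<in> Mor T Y Z"
  shows "g \<cdot> finsum (Hom T X Y) f A = finsum (Hom T X Z) (\<lambda>i. g \<cdot> f i) A"
  using assms(1,2)
proof (induction A rule: finite_induct)
  case empty
  then show ?case using assms(3) by simp
next
  case (insert a A)
  then show ?case using assms(3)
    by (simp add: Pi_def cmp_closed[OF _ assms(3)] cmp_add_right[OF _ _ assms(3)] Hom.finsum_closed)
qed

lemma cmp_finsum_left:
  assumes "finite A" "\<And>i. i \<in> A \<Longrightarrow> g i \<in> Mor T Y Z" "f \<in> Mor T X Y"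
  shows "finsum (Hom T Y Z) g A \<cdot> f = finsum (Hom T X Z) (\<lambda>i. g i \<cdot> f) A"
  using assms(1,2)
proof (induction A rule: finite_induct)
  case empty
  then show ?case using assms(3) by simp
next
  case (insert a A)
  then show ?case using assms(3)
    by (simp add: Pi_def cmp_closed[OF assms(3)] cmp_add_left[OF assms(3)] Hom.finsum_closed)
qed

lemma finsum_delta:
  assumes "finite A" "a \<in> A" "f a \<in> Mor T X Y"
  shows "finsum (Hom T X Y) (\<lambda>i. if i = a then f i else \<zero>\<^bsub>Hom T X Y\<^esub>) A = f a"
proof -
  have "finsum (Hom T X Y) (\<lambda>i. if i = a then f i else \<zero>\<^bsub>Hom T X Y\<^esub>) A =
      finsum (Hom T X Y) (\<lambda>i. if i = a then (\<lambda>_. f a) i else \<zero>\<^bsub>Hom T X Y\<^esub>) A"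
    by (rule Hom.finsum_cong') (use assms in auto)
  also have "\<dots> = f a"
    by (rule Hom.add.finprod_singleton_swap) (use assms in auto)
  finally show ?thesis .
qed

text \<open>Composition through an intermediate direct sum: if the \<open>s k\<close> and \<open>t l\<close> compose like the
  projections and inclusions of a direct sum, then only the diagonal terms survive.\<close>

lemma cmp_through_sum:
  fixes n :: nat
  assumes u: "\<And>k. k < n \<Longrightarrow> u k \<in> Mor T (Y k) Z" and s: "\<And>k. k < n \<Longrightarrow> s k \<in> Mor T W (Y k)"
    and t: "\<And>l. l < n \<Longrightarrow> t l \<in> Mor T (Y l) W" and v: "\<And>l. l < n \<Longrightarrow> v l \<in> Mor T X (Y l)"
    and st: "\<And>k l. \<lbrakk>k < n; l < n\<rbrakk> \<Longrightarrow>
      s k \<cdot> t l = (if k = l then ident T (Y k) else \<zero>\<^bsub>Hom T (Y l) (Y k)\<^esub>)"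
  shows "finsum (Hom T W Z) (\<lambda>k. u k \<cdot> s k) {..<n} \<cdot> finsum (Hom T X W) (\<lambda>l. t l \<cdot> v l) {..<n} =
    finsum (Hom T X Z) (\<lambda>k. u k \<cdot> v k) {..<n}"
proof -
  have tv: "finsum (Hom T X W) (\<lambda>l. t l \<cdot> v l) {..<n} \<in> Mor T X W"
    by (auto intro!: Hom.finsum_closed cmp_closed intro: t v)
  have "finsum (Hom T W Z) (\<lambda>k. u k \<cdot> s k) {..<n} \<cdot> finsum (Hom T X W) (\<lambda>l. t l \<cdot> v l) {..<n} =
      finsum (Hom T X Z) (\<lambda>k. (u k \<cdot> s k) \<cdot> finsum (Hom T X W) (\<lambda>l. t l \<cdot> v l) {..<n}) {..<n}"
    by (rule cmp_finsum_left) (auto intro!: cmp_closed tv intro: u s)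
  also have "\<dots> = finsum (Hom T X Z) (\<lambda>k. u k \<cdot> v k) {..<n}"
  proof (rule Hom.finsum_cong')
    fix k assume "k \<in> {..<n}"
    then have k: "k < n" by simp
    have us: "u k \<cdot> s k \<in> Mor T W Z" using u s k cmp_closed by blast
    have "(u k \<cdot> s k) \<cdot> finsum (Hom T X W) (\<lambda>l. t l \<cdot> v l) {..<n} =
        finsum (Hom T X Z) (\<lambda>l. (u k \<cdot> s k) \<cdot> (t l \<cdot> v l)) {..<n}"
      by (rule cmp_finsum_right) (auto intro!: cmp_closed us intro: t v)
    also have "\<dots> = finsum (Hom T X Z) (\<lambda>l. if l = k then u l \<cdot> v l else \<zero>\<^bsub>Hom T X Z\<^esub>) {..<n}"
    proof (rule Hom.finsum_cong')
      fix l assume "l \<in> {..<n}"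
      then have l: "l < n" by simp
      have "(u k \<cdot> s k) \<cdot> (t l \<cdot> v l) = u k \<cdot> ((s k \<cdot> t l) \<cdot> v l)"
        using cmp_assoc[OF cmp_closed[OF v[OF l] t[OF l]] s[OF k] u[OF k]]
          cmp_assoc[OF v[OF l] t[OF l] s[OF k]] by simp
      also have "\<dots> = (if l = k then u l \<cdot> v l else \<zero>\<^bsub>Hom T X Z\<^esub>)"
        using st[OF k l] u[OF k] v[OF l] cmp_ident_left[OF v[OF l]] by auto
      finally show "(u k \<cdot> s k) \<cdot> (t l \<cdot> v l) = (if l = k then u l \<cdot> v l else \<zero>\<^bsub>Hom T X Z\<^esub>)" .
    qed (auto intro!: cmp_closed intro: u v)
    also have "\<dots> = u k \<cdot> v k"
      using k by (intro finsum_delta) (auto intro!: cmp_closed intro: u v)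
    finally show "(u k \<cdot> s k) \<cdot> finsum (Hom T X W) (\<lambda>l. t l \<cdot> v l) {..<n} = u k \<cdot> v k" .
  qed (auto intro!: cmp_closed intro: u v)
  finally show ?thesis .
qed

lemma finsum_lessThan_Suc:
  assumes "\<And>i. i < Suc n \<Longrightarrow> f i \<in> Mor T X Y"
  shows "finsum (Hom T X Y) f {..<Suc n} =
    f 0 \<oplus>\<^bsub>Hom T X Y\<^esub> finsum (Hom T X Y) (\<lambda>i. f (Suc i)) {..<n}"
proof -
  have "finsum (Hom T X Y) f {..<Suc n} = f 0 \<oplus>\<^bsub>Hom T X Y\<^esub> finsum (Hom T X Y) f (Suc ` {..<n})"
    unfolding lessThan_Suc_eq_insert_0 by (rule Hom.finsum_insert) (use assms in auto)
  also have "finsum (Hom T X Y) f (Suc ` {..<n}) = finsum (Hom T X Y) (\<lambda>i. f (Suc i)) {..<n}"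
    by (rule Hom.finsum_reindex) (use assms in auto)
  finally show ?thesis .
qed

lemma is_direct_sumE:
  assumes "is_direct_sum T X Xs"
  obtains inc prj where "\<And>i. i < length Xs \<Longrightarrow> inc i \<in> Mor T (Xs ! i) X"
    and "\<And>i. i < length Xs \<Longrightarrow> prj i \<in> Mor T X (Xs ! i)"
    and "\<And>i j. \<lbrakk>i < length Xs; j < length Xs\<rbrakk> \<Longrightarrow>
      prj i \<cdot> inc j = (if i = j then ident T (Xs ! i) else \<zero>\<^bsub>Hom T (Xs ! j) (Xs ! i)\<^esub>)"
    and "finsum (Hom T X X) (\<lambda>i. inc i \<cdot> prj i) {..<length Xs} = ident T X"
  using assms unfolding is_direct_sum_def by blast

lemma is_direct_sum_pair_iff:
  "is_direct_sum T X [A, B] \<longleftrightarrow> (\<exists>i\<in>Mor T A X. \<exists>j\<in>Mor T B X. \<exists>p\<in>Mor T X A. \<exists>q\<in>Mor T X B.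
    p \<cdot> i = ident T A \<and> q \<cdot> j = ident T B \<and> p \<cdot> j = \<zero>\<^bsub>Hom T B A\<^esub> \<and> q \<cdot> i = \<zero>\<^bsub>Hom T A B\<^esub> \<and>
    (i \<cdot> p) \<oplus>\<^bsub>Hom T X X\<^esub> (j \<cdot> q) = ident T X)" (is "?L \<longleftrightarrow> ?R")
proof
  assume ?L
  then obtain inc prj where *: "\<forall>i < 2. inc i \<in> Mor T ([A, B] ! i) X \<and> prj i \<in> Mor T X ([A, B] ! i)"
    "\<forall>i < 2. \<forall>j < 2. prj i \<cdot> inc j =
       (if i = j then ident T ([A, B] ! i) else \<zero>\<^bsub>Hom T ([A, B] ! j) ([A, B] ! i)\<^esub>)"
    "finsum (Hom T X X) (\<lambda>i. inc i \<cdot> prj i) {..<2} = ident T X"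
    unfolding is_direct_sum_def by (auto simp: numeral_2_eq_2)
  have mor: "inc 0 \<in> Mor T A X" "inc 1 \<in> Mor T B X" "prj 0 \<in> Mor T X A" "prj 1 \<in> Mor T X B"
    using *(1)[rule_format, of 0] *(1)[rule_format, of 1] by auto
  have "finsum (Hom T X X) (\<lambda>i. inc i \<cdot> prj i) {..<Suc (Suc 0)} =
      (inc 0 \<cdot> prj 0) \<oplus>\<^bsub>Hom T X X\<^esub> (inc 1 \<cdot> prj 1)"
    using mor cmp_closed by (subst finsum_lessThan_Suc) (auto simp: less_Suc_eq lessThan_Suc)
  then have "(inc 0 \<cdot> prj 0) \<oplus>\<^bsub>Hom T X X\<^esub> (inc 1 \<cdot> prj 1) = ident T X"
    using *(3) by (simp add: numeral_2_eq_2)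
  moreover have "prj 0 \<cdot> inc 0 = ident T A" "prj 1 \<cdot> inc 1 = ident T B"
    "prj 0 \<cdot> inc 1 = \<zero>\<^bsub>Hom T B A\<^esub>" "prj 1 \<cdot> inc 0 = \<zero>\<^bsub>Hom T A B\<^esub>"
    using *(2)[rule_format, of 0 0] *(2)[rule_format, of 1 1] *(2)[rule_format, of 0 1]
      *(2)[rule_format, of 1 0] by auto
  ultimately show ?R using mor by blast
next
  assume ?R
  then obtain i j p q where *: "i \<in> Mor T A X" "j \<in> Mor T B X" "p \<in> Mor T X A" "q \<in> Mor T X B"
    "p \<cdot> i = ident T A" "q \<cdot> j = ident T B" "p \<cdot> j = \<zero>\<^bsub>Hom T B A\<^esub>" "q \<cdot> i = \<zero>\<^bsub>Hom T A B\<^esub>"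
    "(i \<cdot> p) \<oplus>\<^bsub>Hom T X X\<^esub> (j \<cdot> q) = ident T X" by blast
  let ?inc = "\<lambda>k::nat. if k = 0 then i else j" and ?prj = "\<lambda>k::nat. if k = 0 then p else q"
  have "finsum (Hom T X X) (\<lambda>k. ?inc k \<cdot> ?prj k) {..<Suc (Suc 0)} = ident T X"
    using * cmp_closed by (subst finsum_lessThan_Suc) (auto simp: less_Suc_eq lessThan_Suc)
  then show ?L unfolding is_direct_sum_def
    by (intro exI[of _ ?inc] exI[of _ ?prj]) (use * in \<open>auto simp: less_Suc_eq nth_Cons'\<close>)
qed

text \<open>Direct sums may be formed in two steps.\<close>

lemma is_direct_sum_Cons:
  assumes D: "is_direct_sum T D [X, S]" and S: "is_direct_sum T S Xs"
  shows "is_direct_sum T D (X # Xs)"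
proof -
  obtain i j p q where ij: "i \<in> Mor T X D" "j \<in> Mor T S D" "p \<in> Mor T D X" "q \<in> Mor T D S"
    "p \<cdot> i = ident T X" "q \<cdot> j = ident T S" "p \<cdot> j = \<zero>\<^bsub>Hom T S X\<^esub>" "q \<cdot> i = \<zero>\<^bsub>Hom T X S\<^esub>"
    "(i \<cdot> p) \<oplus>\<^bsub>Hom T D D\<^esub> (j \<cdot> q) = ident T D"
    using D unfolding is_direct_sum_pair_iff by blast
  obtain inc prj where inc: "\<And>k. k < length Xs \<Longrightarrow> inc k \<in> Mor T (Xs ! k) S"
    and prj: "\<And>k. k < length Xs \<Longrightarrow> prj k \<in> Mor T S (Xs ! k)"
    and pi: "\<And>k l. \<lbrakk>k < length Xs; l < length Xs\<rbrakk> \<Longrightarrow>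
      prj k \<cdot> inc l = (if k = l then ident T (Xs ! k) else \<zero>\<^bsub>Hom T (Xs ! l) (Xs ! k)\<^esub>)"
    and sm: "finsum (Hom T S S) (\<lambda>k. inc k \<cdot> prj k) {..<length Xs} = ident T S"
    by (rule is_direct_sumE[OF S]) (rule that)
  define inc' where "inc' = case_nat i (\<lambda>k. j \<cdot> inc k)"
  define prj' where "prj' = case_nat p (\<lambda>k. prj k \<cdot> q)"
  have mor: "inc' k \<in> Mor T ((X # Xs) ! k) D \<and> prj' k \<in> Mor T D ((X # Xs) ! k)"
    if "k < Suc (length Xs)" for k
    using that ij inc prj by (cases k) (auto simp: inc'_def prj'_def intro: cmp_closed)
  have pq: "(prj k \<cdot> q) \<cdot> (j \<cdot> inc l) = prj k \<cdot> inc l" if "k < length Xs" "l < length Xs" for k l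
  proof -
    have "(prj k \<cdot> q) \<cdot> (j \<cdot> inc l) = prj k \<cdot> ((q \<cdot> j) \<cdot> inc l)"
      using cmp_assoc[OF cmp_closed[OF inc[OF that(2)] ij(2)] ij(4) prj[OF that(1)]]
        cmp_assoc[OF inc[OF that(2)] ij(2,4)] by simp
    then show ?thesis using ij(6) cmp_ident_left[OF inc[OF that(2)]] by simp
  qed
  have "prj' k \<cdot> inc' l = (if k = l then ident T ((X # Xs) ! k)
      else \<zero>\<^bsub>Hom T ((X # Xs) ! l) ((X # Xs) ! k)\<^esub>)"
    if "k < Suc (length Xs)" "l < Suc (length Xs)" for k l
  proof (cases k; cases l)
    fix l' assume "k = 0" "l = Suc l'"
    moreover then have "p \<cdot> (j \<cdot> inc l') = \<zero>\<^bsub>Hom T (Xs ! l') X\<^esub>"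
      using that(2) cmp_assoc[OF inc[of l'] ij(2,3)] ij(7) inc[of l'] by auto
    ultimately show ?thesis by (simp add: inc'_def prj'_def)
  next
    fix k' assume "k = Suc k'" "l = 0"
    moreover then have "(prj k' \<cdot> q) \<cdot> i = \<zero>\<^bsub>Hom T X (Xs ! k')\<^esub>"
      using that(1) cmp_assoc[OF ij(1,4) prj[of k']] ij(8) prj[of k'] by auto
    ultimately show ?thesis by (simp add: inc'_def prj'_def)
  qed (use that ij(5) pq pi in \<open>auto simp: inc'_def prj'_def\<close>)
  moreover have "finsum (Hom T D D) (\<lambda>k. inc' k \<cdot> prj' k) {..<Suc (length Xs)} = ident T D"
  proof -
    have "finsum (Hom T D D) (\<lambda>k. inc' k \<cdot> prj' k) {..<Suc (length Xs)} =
        (i \<cdot> p) \<oplus>\<^bsub>Hom T D D\<^esub> finsum (Hom T D D) (\<lambda>k. (j \<cdot> inc k) \<cdot> (prj k \<cdot> q)) {..<length Xs}"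
      using finsum_lessThan_Suc[of "length Xs" "\<lambda>k. inc' k \<cdot> prj' k" D D] mor cmp_closed
      by (fastforce simp: inc'_def prj'_def)
    also have "finsum (Hom T D D) (\<lambda>k. (j \<cdot> inc k) \<cdot> (prj k \<cdot> q)) {..<length Xs} =
        finsum (Hom T D D) (\<lambda>k. j \<cdot> ((inc k \<cdot> prj k) \<cdot> q)) {..<length Xs}"
    proof (rule Hom.finsum_cong')
      fix k assume "k \<in> {..<length Xs}"
      then have k: "k < length Xs" by simp
      show "(j \<cdot> inc k) \<cdot> (prj k \<cdot> q) = j \<cdot> ((inc k \<cdot> prj k) \<cdot> q)"
        using cmp_assoc[OF cmp_closed[OF ij(4) prj[OF k]] inc[OF k] ij(2)]
          cmp_assoc[OF ij(4) prj[OF k] inc[OF k]] by simp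
    qed (auto intro!: cmp_closed ij(2,4) intro: inc prj)
    also have "\<dots> = j \<cdot> finsum (Hom T D S) (\<lambda>k. (inc k \<cdot> prj k) \<cdot> q) {..<length Xs}"
      by (rule cmp_finsum_right[symmetric]) (auto intro!: cmp_closed ij(2,4) intro: inc prj)
    also have "finsum (Hom T D S) (\<lambda>k. (inc k \<cdot> prj k) \<cdot> q) {..<length Xs} =
        finsum (Hom T S S) (\<lambda>k. inc k \<cdot> prj k) {..<length Xs} \<cdot> q"
      by (rule cmp_finsum_left[symmetric]) (auto intro!: cmp_closed ij(2,4) intro: inc prj)
    finally show ?thesis using sm ij(4,9) cmp_ident_left[OF ij(4)] by simp
  qed
  ultimately show ?thesis
    unfolding is_direct_sum_def by (intro exI[of _ inc'] exI[of _ prj']) (use mor in auto)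
qed

lemma is_direct_sum_permute:
  assumes "is_direct_sum T X Xs" and "mset Ys = mset Xs"
  shows "is_direct_sum T X Ys"
proof -
  obtain inc prj where inc: "\<And>k. k < length Xs \<Longrightarrow> inc k \<in> Mor T (Xs ! k) X"
    and prj: "\<And>k. k < length Xs \<Longrightarrow> prj k \<in> Mor T X (Xs ! k)"
    and pi: "\<And>k l. \<lbrakk>k < length Xs; l < length Xs\<rbrakk> \<Longrightarrow>
      prj k \<cdot> inc l = (if k = l then ident T (Xs ! k) else \<zero>\<^bsub>Hom T (Xs ! l) (Xs ! k)\<^esub>)"
    and sm: "finsum (Hom T X X) (\<lambda>k. inc k \<cdot> prj k) {..<length Xs} = ident T X"
    by (rule is_direct_sumE[OF assms(1)]) (rule that)
  obtain \<pi> where \<pi>: "\<pi> permutes {..<length Xs}" "permute_list \<pi> Xs = Ys"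
    using mset_eq_permutation[OF assms(2)] .
  have len: "length Ys = length Xs" using \<pi>(2) by auto
  have lt: "\<pi> k < length Xs" if "k < length Xs" for k
    using permutes_in_image[OF \<pi>(1), of k] that by simp
  have nth: "Ys ! k = Xs ! \<pi> k" if "k < length Xs" for k
    using permute_list_nth[OF \<pi>(1) that] \<pi>(2) by simp
  have "finsum (Hom T X X) (\<lambda>k. inc k \<cdot> prj k) (\<pi> ` {..<length Xs}) =
      finsum (Hom T X X) (\<lambda>k. inc (\<pi> k) \<cdot> prj (\<pi> k)) {..<length Xs}"
    by (rule Hom.finsum_reindex)
      (use permutes_image[OF \<pi>(1)] permutes_inj_on[OF \<pi>(1)] in \<open>auto intro!: cmp_closed intro: inc prj\<close>)
  then have "finsum (Hom T X X) (\<lambda>k. inc (\<pi> k) \<cdot> prj (\<pi> k)) {..<length Xs} = ident T X"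
    using sm permutes_image[OF \<pi>(1)] by simp
  moreover have "\<pi> k = \<pi> l \<longleftrightarrow> k = l" for k l
    using permutes_inj[OF \<pi>(1)] by (auto dest: injD)
  ultimately show ?thesis unfolding is_direct_sum_def len
    by (intro exI[of _ "\<lambda>k. inc (\<pi> k)"] exI[of _ "\<lambda>k. prj (\<pi> k)"]) (use inc prj pi nth lt in auto)
qed

lemma zero_object_iff: "zero_object T Z \<longleftrightarrow> ident T Z = \<zero>\<^bsub>Hom T Z Z\<^esub>"
proof
  assume "ident T Z = \<zero>\<^bsub>Hom T Z Z\<^esub>"
  then have "f = \<zero>\<^bsub>Hom T X Z\<^esub>" "g = \<zero>\<^bsub>Hom T Z X\<^esub>"
    if "f \<in> Mor T X Z" "g \<in> Mor T Z X" for f g X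
    using that cmp_ident_left[of f X Z] cmp_ident_right[of g Z X] by auto
  then show "zero_object T Z" unfolding zero_object_def by blast
next
  assume "zero_object T Z"
  then show "ident T Z = \<zero>\<^bsub>Hom T Z Z\<^esub>" using ident_closed[of Z] by (auto simp: zero_object_def)
qed

lemma is_direct_sum_Nil_iff: "is_direct_sum T X [] \<longleftrightarrow> zero_object T X"
  by (auto simp: is_direct_sum_def zero_object_iff)

lemma isomorphic_refl: "isomorphic T X X"
  unfolding isomorphic_def is_iso_def using ident_closed[of X] cmp_ident_left[of "ident T X" X X] by blast

lemma isomorphic_sym: "isomorphic T X Y \<Longrightarrow> isomorphic T Y X"
  unfolding isomorphic_def is_iso_def by blast

lemma isomorphic_direct_sum:
  assumes "isomorphic T X Y" "zero_object T Z"
  shows "is_direct_sum T X [Y, Z]"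
proof -
  obtain f f' where f: "f \<in> Mor T X Y" "f' \<in> Mor T Y X" "f' \<cdot> f = ident T X" "f \<cdot> f' = ident T Y"
    using assms(1) unfolding isomorphic_def is_iso_def by blast
  have z: "\<zero>\<^bsub>Hom T Z X\<^esub> \<cdot> \<zero>\<^bsub>Hom T X Z\<^esub> = \<zero>\<^bsub>Hom T X X\<^esub>" by simp
  show ?thesis unfolding is_direct_sum_pair_iff
    by (rule bexI[of _ f'], rule bexI[of _ "\<zero>\<^bsub>Hom T Z X\<^esub>"], rule bexI[of _ f],
        rule bexI[of _ "\<zero>\<^bsub>Hom T X Z\<^esub>"])
      (use f ident_closed[of X] assms(2)[unfolded zero_object_iff] in \<open>auto simp: z\<close>)
qed

end


section \<open>Shifts, direct sums and closures in a triangulated category\<close>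

context triangulated_category
begin

lemma is_direct_sum_exists: "\<exists>S. is_direct_sum T S Xs"
proof (induction Xs)
  case Nil
  then show ?case using zero_object_exists is_direct_sum_Nil_iff by blast
next
  case (Cons X Xs)
  then show ?case using direct_sum_exists is_direct_sum_Cons by blast
qed

text \<open>The complement of the first summand is any direct sum \<open>R\<close> of the remaining objects, embedded in
  \<open>G\<close> by means of the inclusions and projections of \<open>R\<close> and of \<open>G\<close>.\<close>

lemma is_direct_sum_ConsE:
  assumes "is_direct_sum T G (X # Xs)"
  obtains R where "is_direct_sum T G [X, R]" and "is_direct_sum T R Xs"
proof -
  let ?n = "length Xs"
  obtain inc prj where inc: "\<And>k. k < Suc ?n \<Longrightarrow> inc k \<in> Mor T ((X # Xs) ! k) G"
    and prj: "\<And>k. k < Suc ?n \<Longrightarrow> prj k \<in> Mor T G ((X # Xs) ! k)"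
    and pi: "\<And>k l. \<lbrakk>k < Suc ?n; l < Suc ?n\<rbrakk> \<Longrightarrow> prj k \<cdot> inc l =
      (if k = l then ident T ((X # Xs) ! k) else \<zero>\<^bsub>Hom T ((X # Xs) ! l) ((X # Xs) ! k)\<^esub>)"
    and sm: "finsum (Hom T G G) (\<lambda>k. inc k \<cdot> prj k) {..<Suc ?n} = ident T G"
    by (rule is_direct_sumE[OF assms, unfolded length_Cons]) (rule that)
  obtain R where R: "is_direct_sum T R Xs" using is_direct_sum_exists by blast
  obtain incR prjR where incR: "\<And>k. k < ?n \<Longrightarrow> incR k \<in> Mor T (Xs ! k) R"
    and prjR: "\<And>k. k < ?n \<Longrightarrow> prjR k \<in> Mor T R (Xs ! k)"
    and piR: "\<And>k l. \<lbrakk>k < ?n; l < ?n\<rbrakk> \<Longrightarrow> prjR k \<cdot> incR l =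
      (if k = l then ident T (Xs ! k) else \<zero>\<^bsub>Hom T (Xs ! l) (Xs ! k)\<^esub>)"
    and smR: "finsum (Hom T R R) (\<lambda>k. incR k \<cdot> prjR k) {..<?n} = ident T R"
    by (rule is_direct_sumE[OF R]) (rule that)
  have inc0: "inc 0 \<in> Mor T X G" and prj0: "prj 0 \<in> Mor T G X"
    using inc[of 0] prj[of 0] by auto
  have incS: "inc (Suc k) \<in> Mor T (Xs ! k) G" and prjS: "prj (Suc k) \<in> Mor T G (Xs ! k)"
    if "k < ?n" for k using inc[of "Suc k"] prj[of "Suc k"] that by auto
  have piS: "prj (Suc k) \<cdot> inc (Suc l) =
      (if k = l then ident T (Xs ! k) else \<zero>\<^bsub>Hom T (Xs ! l) (Xs ! k)\<^esub>)" if "k < ?n" "l < ?n" for k l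
    using pi[of "Suc k" "Suc l"] that by simp
  define j where "j = finsum (Hom T R G) (\<lambda>k. inc (Suc k) \<cdot> prjR k) {..<?n}"
  define q where "q = finsum (Hom T G R) (\<lambda>k. incR k \<cdot> prj (Suc k)) {..<?n}"
  have j: "j \<in> Mor T R G" and q: "q \<in> Mor T G R" unfolding j_def q_def
    by (auto intro!: Hom.finsum_closed cmp_closed intro: incS prjS incR prjR)
  have qj: "q \<cdot> j = ident T R" unfolding j_def q_def
    by (subst cmp_through_sum[where Y = "\<lambda>k. Xs ! k"]) (auto intro: incS prjS incR prjR simp: piS smR)
  have jq: "j \<cdot> q = finsum (Hom T G G) (\<lambda>k. inc (Suc k) \<cdot> prj (Suc k)) {..<?n}" unfolding j_def q_def
    by (subst cmp_through_sum[where Y = "\<lambda>k. Xs ! k"]) (auto intro: incS prjS incR prjR simp: piR)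
  have "prj 0 \<cdot> j = finsum (Hom T R X) (\<lambda>k. prj 0 \<cdot> (inc (Suc k) \<cdot> prjR k)) {..<?n}"
    unfolding j_def by (rule cmp_finsum_right) (auto intro!: cmp_closed intro: prjR incS prj0)
  also have "\<dots> = finsum (Hom T R X) (\<lambda>k. \<zero>\<^bsub>Hom T R X\<^esub>) {..<?n}"
  proof (rule Hom.finsum_cong')
    fix k assume "k \<in> {..<?n}"
    then have k: "k < ?n" by simp
    show "prj 0 \<cdot> (inc (Suc k) \<cdot> prjR k) = \<zero>\<^bsub>Hom T R X\<^esub>"
      using cmp_assoc[OF prjR[OF k] incS[OF k] prj0] pi[of 0 "Suc k"] k cmp_zero_left[OF prjR[OF k]]
      by simp
  qed auto
  finally have pj: "prj 0 \<cdot> j = \<zero>\<^bsub>Hom T R X\<^esub>" by (simp add: Hom.finsum_zero)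
  have "q \<cdot> inc 0 = finsum (Hom T X R) (\<lambda>k. (incR k \<cdot> prj (Suc k)) \<cdot> inc 0) {..<?n}"
    unfolding q_def by (rule cmp_finsum_left) (auto intro!: cmp_closed intro: incR prjS inc0)
  also have "\<dots> = finsum (Hom T X R) (\<lambda>k. \<zero>\<^bsub>Hom T X R\<^esub>) {..<?n}"
  proof (rule Hom.finsum_cong')
    fix k assume "k \<in> {..<?n}"
    then have k: "k < ?n" by simp
    show "(incR k \<cdot> prj (Suc k)) \<cdot> inc 0 = \<zero>\<^bsub>Hom T X R\<^esub>"
      using cmp_assoc[OF inc0 prjS[OF k] incR[OF k]] pi[of "Suc k" 0] k cmp_zero_right[OF incR[OF k]]
      by simp
  qed auto
  finally have qi: "q \<cdot> inc 0 = \<zero>\<^bsub>Hom T X R\<^esub>" by (simp add: Hom.finsum_zero)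
  have "(inc 0 \<cdot> prj 0) \<oplus>\<^bsub>Hom T G G\<^esub> (j \<cdot> q) = ident T G"
    unfolding jq sm[symmetric]
    by (rule finsum_lessThan_Suc[symmetric]) (auto intro!: cmp_closed intro: inc prj)
  then have "is_direct_sum T G [X, R]" unfolding is_direct_sum_pair_iff
    using inc0 prj0 j q qj pj qi pi[of 0 0] by fastforce
  then show thesis using that R by blast
qed

lemma additive_closed_direct_sum_iff:
  assumes S: "additive_summand_closed T \<S>" and "is_direct_sum T X Xs"
  shows "X \<in> \<S> \<longleftrightarrow> set Xs \<subseteq> \<S>"
  using assms(2)
proof (induction Xs arbitrary: X)
  case Nil
  then show ?case using S by (simp add: is_direct_sum_Nil_iff additive_summand_closed_def)
next
  case (Cons Y Ys)
  obtain R where R: "is_direct_sum T X [Y, R]" "is_direct_sum T R Ys"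
    using is_direct_sum_ConsE[OF Cons.prems] .
  have "X \<in> \<S> \<longleftrightarrow> Y \<in> \<S> \<and> R \<in> \<S>" using S R(1) unfolding additive_summand_closed_def by blast
  then show ?case using Cons.IH[OF R(2)] by simp
qed

lemma additive_closed_isomorphic:
  assumes "additive_summand_closed T \<S>" "isomorphic T X Y" "X \<in> \<S>"
  shows "Y \<in> \<S>"
proof -
  obtain Z where Z: "zero_object T Z" using zero_object_exists by blast
  show ?thesis
    using isomorphic_direct_sum[OF assms(2) Z] assms(1,3) unfolding additive_summand_closed_def by blast
qed

lemma shift_map_zero_mor [simp]:
  "shift_map T n \<zero>\<^bsub>Hom T X Y\<^esub> = \<zero>\<^bsub>Hom T (shift T n X) (shift T n Y)\<^esub>"
proof -
  have "shift_map T n (0 \<odot>\<^bsub>Hom T X Y\<^esub> \<zero>\<^bsub>Hom T X Y\<^esub>) =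
      0 \<odot>\<^bsub>Hom T (shift T n X) (shift T n Y)\<^esub> shift_map T n \<zero>\<^bsub>Hom T X Y\<^esub>"
    by (rule shift_map_smult) simp
  then show ?thesis using shift_map_closed[of "\<zero>\<^bsub>Hom T X Y\<^esub>" X Y n] by simp
qed

lemma shift_map_uminus_shift_map [simp]: "f \<in> Mor T X Y \<Longrightarrow> shift_map T (- n) (shift_map T n f) = f"
  using shift_map_shift_map[of f X Y "- n" n] shift_map_zero by simp

lemma shift_uminus_shift [simp]:
  "shift T (- n) (shift T n X) = X" "shift T n (shift T (- n) X) = X"
  using shift_shift shift_zero by simp_all

lemma shift_map_eq_zero_iff:
  assumes "f \<in> Mor T X Y"
  shows "shift_map T n f = \<zero>\<^bsub>Hom T (shift T n X) (shift T n Y)\<^esub> \<longleftrightarrow> f = \<zero>\<^bsub>Hom T X Y\<^esub>"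
proof
  assume "shift_map T n f = \<zero>\<^bsub>Hom T (shift T n X) (shift T n Y)\<^esub>"
  then have "shift_map T (- n) (shift_map T n f) = \<zero>\<^bsub>Hom T X Y\<^esub>" by simp
  then show "f = \<zero>\<^bsub>Hom T X Y\<^esub>" using assms by simp
qed simp

lemma shift_map_finsum:
  assumes "finite A" "\<And>i. i \<in> A \<Longrightarrow> f i \<in> Mor T X Y"
  shows "shift_map T n (finsum (Hom T X Y) f A) =
    finsum (Hom T (shift T n X) (shift T n Y)) (\<lambda>i. shift_map T n (f i)) A"
  using assms
proof (induction A rule: finite_induct)
  case (insert a A)
  then show ?case
    by (simp add: Pi_def shift_map_closed shift_map_add Hom.finsum_closed)
qed simp

lemma isomorphic_shift:
  assumes "isomorphic T X Y"
  shows "isomorphic T (shift T n X) (shift T n Y)"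
proof -
  obtain f g where f: "f \<in> Mor T X Y" "g \<in> Mor T Y X" "g \<cdot> f = ident T X" "f \<cdot> g = ident T Y"
    using assms unfolding isomorphic_def is_iso_def by blast
  then have "shift_map T n g \<cdot> shift_map T n f = ident T (shift T n X)"
    "shift_map T n f \<cdot> shift_map T n g = ident T (shift T n Y)"
    by (metis shift_map_cmp shift_map_ident)+
  then show ?thesis unfolding isomorphic_def is_iso_def using f(1,2) shift_map_closed by blast
qed

lemma isomorphic_shift_iff:
  "isomorphic T (shift T n X) (shift T n Y) \<longleftrightarrow> isomorphic T X Y"
  using isomorphic_shift[of X Y n] isomorphic_shift[of "shift T n X" "shift T n Y" "- n"] by auto

lemma is_direct_sum_pair_shift:
  assumes "is_direct_sum T X [A, B]"
  shows "is_direct_sum T (shift T n X) [shift T n A, shift T n B]"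
proof -
  obtain i j p q where ij: "i \<in> Mor T A X" "j \<in> Mor T B X" "p \<in> Mor T X A" "q \<in> Mor T X B"
    "p \<cdot> i = ident T A" "q \<cdot> j = ident T B" "p \<cdot> j = \<zero>\<^bsub>Hom T B A\<^esub>" "q \<cdot> i = \<zero>\<^bsub>Hom T A B\<^esub>"
    "(i \<cdot> p) \<oplus>\<^bsub>Hom T X X\<^esub> (j \<cdot> q) = ident T X"
    using assms unfolding is_direct_sum_pair_iff by blast
  let ?s = "shift_map T n"
  have "?s p \<cdot> ?s i = ident T (shift T n A)" "?s q \<cdot> ?s j = ident T (shift T n B)"
    "?s p \<cdot> ?s j = \<zero>\<^bsub>Hom T (shift T n B) (shift T n A)\<^esub>"
    "?s q \<cdot> ?s i = \<zero>\<^bsub>Hom T (shift T n A) (shift T n B)\<^esub>"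
    using ij shift_map_cmp[OF ij(1,3), of n] shift_map_cmp[OF ij(2,4), of n]
      shift_map_cmp[OF ij(2,3), of n] shift_map_cmp[OF ij(1,4), of n] by (simp_all add: shift_map_ident)
  moreover have "(?s i \<cdot> ?s p) \<oplus>\<^bsub>Hom T (shift T n X) (shift T n X)\<^esub> (?s j \<cdot> ?s q) = ident T (shift T n X)"
    using shift_map_add[OF cmp_closed[OF ij(3,1)] cmp_closed[OF ij(4,2)], of n] ij(9)
      shift_map_cmp[OF ij(3,1), of n] shift_map_cmp[OF ij(4,2), of n] by (simp add: shift_map_ident)
  ultimately show ?thesis unfolding is_direct_sum_pair_iff
    using ij(1-4)[THEN shift_map_closed, of n] by blast
qed

lemma zero_object_shift_iff: "zero_object T (shift T n Z) \<longleftrightarrow> zero_object T Z"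
  using shift_map_eq_zero_iff[OF ident_closed[of Z], of n] by (simp add: zero_object_iff shift_map_ident)

lemma indecomposable_shift:
  assumes "indecomposable T X"
  shows "indecomposable T (shift T n X)"
  unfolding indecomposable_def
proof (intro conjI allI impI)
  show "\<not> zero_object T (shift T n X)"
    using assms by (simp add: zero_object_shift_iff indecomposable_def)
next
  fix A B assume "is_direct_sum T (shift T n X) [A, B]"
  then have "is_direct_sum T X [shift T (- n) A, shift T (- n) B]"
    using is_direct_sum_pair_shift[of "shift T n X" A B "- n"] by simp
  then show "zero_object T A \<or> zero_object T B"
    using assms unfolding indecomposable_def by (metis zero_object_shift_iff)
qed

lemma shift_indec1:
  assumes "P \<in> indec1 T G"
  shows "shift T (int n) P \<in> indec1 T G"
proof (induction n)
  case 0
  then show ?case using assms by (simp add: shift_zero)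
next
  case (Suc n)
  have "shift T 1 (shift T (int n) P) \<in> indec1 T G"
    using Suc indecomposable_shift unfolding indec1_def thick_closure1_def by blast
  then show ?case by (simp add: shift_shift)
qed

lemma summand_indec1:
  assumes "is_direct_sum T G Gs" "P \<in> set Gs" "indecomposable T P"
  shows "P \<in> indec1 T G"
  using assms additive_closed_direct_sum_iff[OF _ assms(1)]
  unfolding indec1_def thick_closure1_def by blast

text \<open>In a minimal generator, no summand is isomorphic to a shift of another one, since otherwise
  it could be omitted.\<close>

lemma minimal_generator_summands:
  assumes min: "minimal_generator T G" and sum: "is_direct_sum T G Gs"
    and nz: "\<forall>P \<in> set Gs. \<not> zero_object T P"
    and ij: "i < length Gs" "j < length Gs" "i \<noteq> j"
  shows "\<not> isomorphic T (shift T n (Gs ! j)) (Gs ! i)"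
proof
  assume iso: "isomorphic T (shift T n (Gs ! j)) (Gs ! i)"
  let ?Rs = "take i Gs @ drop (Suc i) Gs"
  have "mset (Gs ! i # ?Rs) = mset Gs"
    using arg_cong[OF id_take_nth_drop[OF ij(1)], of mset] by simp
  then have "is_direct_sum T G (Gs ! i # ?Rs)" using is_direct_sum_permute[OF sum] by simp
  then obtain R where R: "is_direct_sum T G [Gs ! i, R]" "is_direct_sum T R ?Rs"
    using is_direct_sum_ConsE by blast
  have j: "Gs ! j \<in> set ?Rs"
  proof (cases "j < i")
    case True
    then show ?thesis using ij by (auto simp: in_set_conv_nth intro!: exI[of _ j])
  next
    case False
    then have "drop (Suc i) Gs ! (j - Suc i) = Gs ! j" "j - Suc i < length (drop (Suc i) Gs)"
      using ij by auto
    then show ?thesis by (metis UnCI nth_mem set_append)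
  qed
  have "G \<in> \<S>" if S: "thick_subcategory T \<S>" "R \<in> \<S>" for \<S>
  proof -
    have add: "additive_summand_closed T \<S>" using S(1) unfolding thick_subcategory_def by blast
    have "Gs ! j \<in> \<S>" using additive_closed_direct_sum_iff[OF add R(2)] S(2) j by blast
    then have "shift T n (Gs ! j) \<in> \<S>" using S(1) unfolding thick_subcategory_def by blast
    then have "Gs ! i \<in> \<S>" using additive_closed_isomorphic[OF add iso] by simp
    then show ?thesis using add R(1) S(2) unfolding additive_summand_closed_def by blast
  qed
  then have "thick_closure T G \<subseteq> thick_closure T R" unfolding thick_closure_def by blast
  then have "classical_generator T R"
    using min by (auto simp: minimal_generator_def classical_generator_def)
  moreover have "is_direct_sum T G [R, Gs ! i]" using is_direct_sum_permute[OF R(1)] by simp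
  ultimately show False using min nz ij(1) unfolding minimal_generator_def by (meson nth_mem)
qed

end


section \<open>One-dimensional spaces of morphisms\<close>

context linear_category
begin

lemma obj_le_iff:
  "obj_le T Q P \<longleftrightarrow>
    (\<exists>b\<in>Mor T P Q. b \<noteq> \<zero>\<^bsub>Hom T P Q\<^esub> \<and> (\<forall>f\<in>Mor T P Q. \<exists>c. f = c \<odot>\<^bsub>Hom T P Q\<^esub> b))"
proof
  assume "obj_le T Q P"
  then obtain \<phi> :: "'k \<Rightarrow> 'm" where \<phi>: "bij_betw \<phi> UNIV (Mor T P Q)"
    "\<And>a b. \<phi> (a * b) = a \<odot>\<^bsub>Hom T P Q\<^esub> \<phi> b"
    unfolding obj_le_def iso_ground_field_def by blast
  have mor: "\<phi> c \<in> Mor T P Q" for c using \<phi>(1) by (auto simp: bij_betw_def)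
  have eq: "\<phi> c = c \<odot>\<^bsub>Hom T P Q\<^esub> \<phi> 1" for c using \<phi>(2)[of c 1] by simp
  have "\<phi> 1 \<noteq> \<phi> 0" using \<phi>(1) by (metis bij_betw_def injD one_neq_zero)
  then have "\<phi> 1 \<noteq> \<zero>\<^bsub>Hom T P Q\<^esub>" using eq[of 0] mor[of 1] by simp
  moreover have "\<exists>c. f = c \<odot>\<^bsub>Hom T P Q\<^esub> \<phi> 1" if "f \<in> Mor T P Q" for f
    using that \<phi>(1) eq by (metis bij_betw_def imageE)
  ultimately show "\<exists>b\<in>Mor T P Q. b \<noteq> \<zero>\<^bsub>Hom T P Q\<^esub> \<and> (\<forall>f\<in>Mor T P Q. \<exists>c. f = c \<odot>\<^bsub>Hom T P Q\<^esub> b)"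
    using mor by blast
next
  assume "\<exists>b\<in>Mor T P Q. b \<noteq> \<zero>\<^bsub>Hom T P Q\<^esub> \<and> (\<forall>f\<in>Mor T P Q. \<exists>c. f = c \<odot>\<^bsub>Hom T P Q\<^esub> b)"
  then obtain b where b: "b \<in> Mor T P Q" "b \<noteq> \<zero>\<^bsub>Hom T P Q\<^esub>"
    "\<And>f. f \<in> Mor T P Q \<Longrightarrow> \<exists>c. f = c \<odot>\<^bsub>Hom T P Q\<^esub> b" by blast
  have "bij_betw (\<lambda>c. c \<odot>\<^bsub>Hom T P Q\<^esub> b) UNIV (Mor T P Q)"
    unfolding bij_betw_def inj_on_def using b smult_cancel[OF b(1,2)] by auto
  then show "obj_le T Q P" unfolding obj_le_def iso_ground_field_def
    using smult_add_left[OF b(1)] smult_smult[OF b(1)]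
    by (intro exI[of _ "\<lambda>c. c \<odot>\<^bsub>Hom T P Q\<^esub> b"]) auto
qed

lemma obj_le_scalar:
  assumes "obj_le T Q P" and b: "b \<in> Mor T P Q" "b \<noteq> \<zero>\<^bsub>Hom T P Q\<^esub>" and f: "f \<in> Mor T P Q"
  shows "\<exists>c. f = c \<odot>\<^bsub>Hom T P Q\<^esub> b"
proof -
  obtain b' where b': "b' \<in> Mor T P Q" "\<And>f. f \<in> Mor T P Q \<Longrightarrow> \<exists>c. f = c \<odot>\<^bsub>Hom T P Q\<^esub> b'"
    using assms(1) unfolding obj_le_iff by blast
  obtain c d where cd: "f = c \<odot>\<^bsub>Hom T P Q\<^esub> b'" "b = d \<odot>\<^bsub>Hom T P Q\<^esub> b'" using b' b f by metis
  have "d \<noteq> 0" using cd(2) b b'(1) by auto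
  then have "f = (c / d) \<odot>\<^bsub>Hom T P Q\<^esub> b" using cd b'(1) by (simp add: smult_smult)
  then show ?thesis ..
qed

lemma obj_le_isomorphic:
  assumes le: "obj_le T Q P" and isos: "isomorphic T Q Q'" "isomorphic T P P'"
  shows "obj_le T Q' P'"
proof -
  obtain b where b: "b \<in> Mor T P Q" "b \<noteq> \<zero>\<^bsub>Hom T P Q\<^esub>" using le unfolding obj_le_iff by blast
  obtain q q' where q: "q \<in> Mor T Q Q'" "q' \<in> Mor T Q' Q" "q' \<cdot> q = ident T Q" "q \<cdot> q' = ident T Q'"
    using isos(1) unfolding isomorphic_def is_iso_def by blast
  obtain p p' where p: "p \<in> Mor T P P'" "p' \<in> Mor T P' P" "p' \<cdot> p = ident T P" "p \<cdot> p' = ident T P'"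
    using isos(2) unfolding isomorphic_def is_iso_def by blast
  have conj: "q \<cdot> ((q' \<cdot> (f \<cdot> p)) \<cdot> p') = f" if f: "f \<in> Mor T P' Q'" for f
  proof -
    have fp: "f \<cdot> p \<in> Mor T P Q'" using cmp_closed[OF p(1) f] .
    have "q \<cdot> ((q' \<cdot> (f \<cdot> p)) \<cdot> p') = (q \<cdot> (q' \<cdot> (f \<cdot> p))) \<cdot> p'"
      by (rule cmp_assoc[OF p(2) cmp_closed[OF fp q(2)] q(1)])
    also have "q \<cdot> (q' \<cdot> (f \<cdot> p)) = f \<cdot> p"
      using cmp_assoc[OF fp q(2,1)] q(4) cmp_ident_left[OF fp] by simp
    also have "(f \<cdot> p) \<cdot> p' = f" using cmp_assoc[OF p(2,1) f] p(4) cmp_ident_right[OF f] by simp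
    finally show ?thesis .
  qed
  have conj': "q' \<cdot> ((q \<cdot> (b \<cdot> p')) \<cdot> p) = b"
  proof -
    have bp: "b \<cdot> p' \<in> Mor T P' Q" using cmp_closed[OF p(2) b(1)] .
    have "q' \<cdot> ((q \<cdot> (b \<cdot> p')) \<cdot> p) = (q' \<cdot> (q \<cdot> (b \<cdot> p'))) \<cdot> p"
      by (rule cmp_assoc[OF p(1) cmp_closed[OF bp q(1)] q(2)])
    also have "q' \<cdot> (q \<cdot> (b \<cdot> p')) = b \<cdot> p'"
      using cmp_assoc[OF bp q(1,2)] q(3) cmp_ident_left[OF bp] by simp
    also have "(b \<cdot> p') \<cdot> p = b" using cmp_assoc[OF p(1,2) b(1)] p(3) cmp_ident_right[OF b(1)] by simp
    finally show ?thesis .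
  qed
  let ?b = "q \<cdot> (b \<cdot> p')"
  have b': "?b \<in> Mor T P' Q'" using b p q cmp_closed by blast
  have "?b \<noteq> \<zero>\<^bsub>Hom T P' Q'\<^esub>"
  proof
    assume "?b = \<zero>\<^bsub>Hom T P' Q'\<^esub>"
    then have "b = \<zero>\<^bsub>Hom T P Q\<^esub>"
      using conj' cmp_zero_left[OF p(1), of Q'] cmp_zero_right[OF q(2), of P] by simp
    then show False using b(2) by simp
  qed
  moreover have "\<exists>c. f = c \<odot>\<^bsub>Hom T P' Q'\<^esub> ?b" if f: "f \<in> Mor T P' Q'" for f
  proof -
    have "q' \<cdot> (f \<cdot> p) \<in> Mor T P Q" using f p q cmp_closed by blast
    then obtain c where c: "q' \<cdot> (f \<cdot> p) = c \<odot>\<^bsub>Hom T P Q\<^esub> b"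
      using obj_le_scalar[OF le b] by blast
    have "f = q \<cdot> ((c \<odot>\<^bsub>Hom T P Q\<^esub> b) \<cdot> p')" using conj[OF f] c by simp
    also have "\<dots> = c \<odot>\<^bsub>Hom T P' Q'\<^esub> ?b"
      using cmp_smult_left[OF p(2) b(1), of c] cmp_smult_right[OF cmp_closed[OF p(2) b(1)] q(1), of c]
      by simp
    finally show ?thesis ..
  qed
  ultimately show ?thesis unfolding obj_le_iff using b' by blast
qed

end

lemma (in triangulated_category) obj_le_shift:
  assumes "obj_le T Q P"
  shows "obj_le T (shift T n Q) (shift T n P)"
proof -
  obtain b where b: "b \<in> Mor T P Q" "b \<noteq> \<zero>\<^bsub>Hom T P Q\<^esub>" using assms unfolding obj_le_iff by blast
  have "\<exists>c. f = c \<odot>\<^bsub>Hom T (shift T n P) (shift T n Q)\<^esub> shift_map T n b"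
    if f: "f \<in> Mor T (shift T n P) (shift T n Q)" for f
  proof -
    have "shift_map T (- n) f \<in> Mor T P Q" using shift_map_closed[OF f, of "- n"] by simp
    then obtain c where c: "shift_map T (- n) f = c \<odot>\<^bsub>Hom T P Q\<^esub> b"
      using obj_le_scalar[OF assms b] by blast
    have "f = shift_map T n (shift_map T (- n) f)"
      using shift_map_uminus_shift_map[OF f, of "- n"] by simp
    also have "\<dots> = c \<odot>\<^bsub>Hom T (shift T n P) (shift T n Q)\<^esub> shift_map T n b"
      unfolding c by (rule shift_map_smult[OF b(1)])
    finally show ?thesis ..
  qed
  then show ?thesis unfolding obj_le_iff
    using b shift_map_closed[OF b(1), of n] shift_map_eq_zero_iff[OF b(1), of n] by blast
qed

lemma (in triangulated_category) obj_le_shift_iff: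
  "obj_le T (shift T n Q) (shift T n P) \<longleftrightarrow> obj_le T Q P"
  using obj_le_shift[of Q P n] obj_le_shift[of "shift T n Q" "shift T n P" "- n"] by auto


section \<open>The order on the shifts of the summands of a linear generator\<close>

text \<open>The consequences of the axioms of a linear generator that carry the argument, for a class
  \<open>J\<close> of objects closed under all shifts.  The last one says that composites of nonzero morphisms
  between objects of \<open>J\<close> are nonzero.\<close>

locale linearly_ordered_objects = triangulated_category +
  fixes J :: "'b set"
  assumes shift_closed: "P \<in> J \<Longrightarrow> shift T n P \<in> J"
    and le_refl: "P \<in> J \<Longrightarrow> obj_le T P P"
    and le_total: "\<lbrakk>P \<in> J; Q \<in> J\<rbrakk> \<Longrightarrow> obj_le T P Q \<or> obj_le T Q P"
    and le_trans: "\<lbrakk>P \<in> J; Q \<in> J; R \<in> J; obj_le T P Q; obj_le T Q R\<rbrakk> \<Longrightarrow> obj_le T P R"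
    and less_zero: "\<lbrakk>P \<in> J; Q \<in> J; obj_le T Q P; \<not> isomorphic T Q P\<rbrakk> \<Longrightarrow>
      Mor T Q P = {\<zero>\<^bsub>Hom T Q P\<^esub>}"
    and le_shift_one: "P \<in> J \<Longrightarrow> obj_le T P (shift T 1 P)"
    and between_shifts: "\<lbrakk>P \<in> J; Q \<in> J; obj_le T P Q; obj_le T Q (shift T 1 P)\<rbrakk> \<Longrightarrow>
      isomorphic T Q P \<or> isomorphic T Q (shift T 1 P)"
    and cmp_nonzero: "\<lbrakk>P \<in> J; Q \<in> J; R \<in> J; f \<in> Mor T P Q; g \<in> Mor T Q R;
      f \<noteq> \<zero>\<^bsub>Hom T P Q\<^esub>; g \<noteq> \<zero>\<^bsub>Hom T Q R\<^esub>\<rbrakk> \<Longrightarrow> g \<cdot> f \<noteq> \<zero>\<^bsub>Hom T P R\<^esub>"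

context triangulated_category
begin

lemma linear_generator_order:
  assumes "linear_generator T G" and I: "I = indec1 T G"
  shows "P \<in> I \<Longrightarrow> obj_le T P P"
    and "\<lbrakk>P \<in> I; Q \<in> I\<rbrakk> \<Longrightarrow> obj_le T P Q \<or> obj_le T Q P"
    and "\<lbrakk>P \<in> I; Q \<in> I; R \<in> I; obj_le T P Q; obj_le T Q R\<rbrakk> \<Longrightarrow> obj_le T P R"
proof -
  define E where "E = iso_rel T I"
  define r where "r = {(E `` {Q}, E `` {P}) | Q P. Q \<in> I \<and> P \<in> I \<and> obj_le T Q P}"
  have "linear_order_on (I // E) r"
    using assms unfolding linear_generator_def Let_def E_def r_def by blast
  then have r: "refl_on (I // E) r" "trans r" "total_on (I // E) r"
    by (auto simp: linear_order_on_def partial_order_on_def preorder_on_def)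
  have E: "E `` {P} = {Q \<in> I. isomorphic T P Q}" if "P \<in> I" for P
    using that by (auto simp: E_def iso_rel_def)
  have E_eq: "isomorphic T P Q" if "P \<in> I" "Q \<in> I" "E `` {P} = E `` {Q}" for P Q
    using that isomorphic_refl[of Q] by (auto simp: E)
  \<comment> \<open>the order on isomorphism classes does not depend on representatives\<close>
  have r_iff: "(E `` {Q}, E `` {P}) \<in> r \<longleftrightarrow> obj_le T Q P" if PQ: "P \<in> I" "Q \<in> I" for P Q
  proof
    assume "(E `` {Q}, E `` {P}) \<in> r"
    then obtain Q' P' where *: "E `` {Q'} = E `` {Q}" "E `` {P'} = E `` {P}" "Q' \<in> I" "P' \<in> I"
      "obj_le T Q' P'" unfolding r_def by (auto simp del: Image_singleton_iff)
    then show "obj_le T Q P" using obj_le_isomorphic[of Q' P' Q P] E_eq PQ by blast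
  qed (use PQ r_def in blast)
  have quot: "E `` {P} \<in> I // E" if "P \<in> I" for P using that by (rule quotientI)
  show refl: "obj_le T P P" if "P \<in> I" for P
    using r(1) quot[OF that] r_iff[OF that that] by (simp add: refl_on_def)
  show "obj_le T P Q \<or> obj_le T Q P" if "P \<in> I" "Q \<in> I" for P Q
  proof (cases "E `` {P} = E `` {Q}")
    case True
    then show ?thesis using obj_le_isomorphic[OF refl[OF that(1)] isomorphic_refl E_eq[OF that True]] by blast
  next
    case False
    then show ?thesis
      using r(3) quot[OF that(1)] quot[OF that(2)] r_iff that unfolding total_on_def by blast
  qed
  show "obj_le T P R" if "P \<in> I" "Q \<in> I" "R \<in> I" "obj_le T P Q" "obj_le T Q R" for P Q R
    using transD[OF r(2), of "E `` {P}" "E `` {Q}" "E `` {R}"] r_iff that by blast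
qed

text \<open>The factorization axiom makes composites of nonzero morphisms nonzero: all spaces of
  morphisms involved are one-dimensional, so that the factors of a nonzero morphism are scalar
  multiples of the given ones.\<close>

lemma linear_generator_cmp_nonzero:
  assumes lin: "linear_generator T G" and I: "I = indec1 T G"
    and PQR: "P \<in> I" "Q \<in> I" "R \<in> I"
    and f: "f \<in> Mor T P Q" "f \<noteq> \<zero>\<^bsub>Hom T P Q\<^esub>" and g: "g \<in> Mor T Q R" "g \<noteq> \<zero>\<^bsub>Hom T Q R\<^esub>"
  shows "g \<cdot> f \<noteq> \<zero>\<^bsub>Hom T P R\<^esub>"
proof
  assume gf: "g \<cdot> f = \<zero>\<^bsub>Hom T P R\<^esub>"
  have le: "obj_le T B A" if AB: "A \<in> I" "B \<in> I" and h: "h \<in> Mor T A B" "h \<noteq> \<zero>\<^bsub>Hom T A B\<^esub>" for A B h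
  proof (rule ccontr)
    assume n: "\<not> obj_le T B A"
    then have "obj_le T A B" using linear_generator_order(2)[OF lin I] AB by blast
    moreover have "\<not> isomorphic T A B"
      using n linear_generator_order(1)[OF lin I AB(1)] obj_le_isomorphic isomorphic_refl by blast
    ultimately have "Mor T A B = {\<zero>\<^bsub>Hom T A B\<^esub>}"
      using lin AB unfolding linear_generator_def Let_def I by blast
    then show False using h by blast
  qed
  have QP: "obj_le T Q P" and RQ: "obj_le T R Q" using le PQR f g by blast+
  then have "obj_le T R P" using linear_generator_order(3)[OF lin I] PQR by blast
  then obtain h where h: "h \<in> Mor T P R" "h \<noteq> \<zero>\<^bsub>Hom T P R\<^esub>" unfolding obj_le_iff by blast
  have "\<forall>P \<in> I. \<forall>Q \<in> I. \<forall>R \<in> I. obj_le T R Q \<and> obj_le T Q P \<longrightarrow>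
        (\<forall>h \<in> Mor T P R. h \<noteq> \<zero>\<^bsub>Hom T P R\<^esub> \<longrightarrow>
           (\<exists>f \<in> Mor T P Q. \<exists>g \<in> Mor T Q R.
              f \<noteq> \<zero>\<^bsub>Hom T P Q\<^esub> \<and> g \<noteq> \<zero>\<^bsub>Hom T Q R\<^esub> \<and> h = g \<cdot> f))"
    using lin unfolding linear_generator_def Let_def I by (elim conjE)
  then obtain f' g' where fg: "f' \<in> Mor T P Q" "g' \<in> Mor T Q R" "h = g' \<cdot> f'"
    using QP RQ PQR h by meson
  obtain c d where "f' = c \<odot>\<^bsub>Hom T P Q\<^esub> f" "g' = d \<odot>\<^bsub>Hom T Q R\<^esub> g"
    using obj_le_scalar[OF QP f fg(1)] obj_le_scalar[OF RQ g fg(2)] by blast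
  then have "h = c \<odot>\<^bsub>Hom T P R\<^esub> (d \<odot>\<^bsub>Hom T P R\<^esub> (g \<cdot> f))"
    using fg(3) cmp_smult_right[OF f(1) smult_closed[OF g(1)]] cmp_smult_left[OF f(1) g(1)] by simp
  then show False using gf h(2) by simp
qed

text \<open>By its definition, \<open>thick_closure1 T G\<close> is closed under \<open>[1]\<close>, but not necessarily under \<open>[-1]\<close>.
  Passing to the objects of which some non-negative shift lies in \<open>indec1 T G\<close> gives a class that is
  closed under all shifts, and that inherits the axioms.\<close>

lemma linear_generator_linearly_ordered_objects:
  assumes lin: "linear_generator T G"
  shows "linearly_ordered_objects T {P. \<exists>n :: nat. shift T (int n) P \<in> indec1 T G}"
    (is "linearly_ordered_objects T ?J")
proof -
  define I where I: "I = indec1 T G"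
  note ord = linear_generator_order[OF lin I]
  have G1: "Mor T Q P = {\<zero>\<^bsub>Hom T Q P\<^esub>}"
    if "P \<in> I" "Q \<in> I" "obj_le T Q P" "\<not> isomorphic T Q P" for P Q
    using lin that unfolding linear_generator_def Let_def I by blast
  have G2: "obj_le T P (shift T 1 P)" if "P \<in> I" for P
    using lin that unfolding linear_generator_def Let_def I by blast
  have G3: "isomorphic T Q P \<or> isomorphic T Q (shift T 1 P)"
    if "P \<in> I" "Q \<in> I" "obj_le T P Q" "obj_le T Q (shift T 1 P)" for P Q
    using lin that unfolding linear_generator_def Let_def I by blast
  have up: "shift T (int m) P \<in> I" if "shift T (int n) P \<in> I" "n \<le> m" for n m P
  proof -
    have "shift T (int (m - n)) (shift T (int n) P) \<in> I" using shift_indec1 that(1) unfolding I .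
    then show ?thesis using that(2) by (simp add: shift_shift of_nat_diff)
  qed
  have common: "\<exists>n. shift T (int n) P \<in> I \<and> shift T (int n) Q \<in> I \<and> shift T (int n) R \<in> I"
    if "P \<in> ?J" "Q \<in> ?J" "R \<in> ?J" for P Q R
  proof -
    obtain a b c where "shift T (int a) P \<in> I" "shift T (int b) Q \<in> I" "shift T (int c) R \<in> I"
      using \<open>P \<in> ?J\<close> \<open>Q \<in> ?J\<close> \<open>R \<in> ?J\<close> unfolding I by blast
    then have "shift T (int (a + b + c)) P \<in> I \<and> shift T (int (a + b + c)) Q \<in> I \<and>
        shift T (int (a + b + c)) R \<in> I"
      using up[of a P "a + b + c"] up[of b Q "a + b + c"] up[of c R "a + b + c"] by simp
    then show ?thesis by blast
  qed
  show ?thesis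
  proof (unfold_locales, goal_cases)
    case (1 P n)
    then obtain m where m: "shift T (int m) P \<in> I" unfolding I by blast
    let ?k = "nat (int m - n)"
    have "shift T (int (nat (int ?k + n))) P \<in> I" by (rule up[OF m]) arith
    moreover have "int (nat (int ?k + n)) = int ?k + n" by arith
    ultimately have "shift T (int ?k) (shift T n P) \<in> I" by (simp only: shift_shift)
    then show ?case unfolding I by blast
  next
    case (2 P)
    then obtain n where "shift T (int n) P \<in> I" using common[of P P P] by blast
    then show ?case using ord(1) obj_le_shift_iff by blast
  next
    case (3 P Q)
    then obtain n where "shift T (int n) P \<in> I" "shift T (int n) Q \<in> I" using common[of P Q P] by blast
    then show ?case using ord(2) obj_le_shift_iff by blast
  next
    case (4 P Q R)
    then obtain n where "shift T (int n) P \<in> I" "shift T (int n) Q \<in> I" "shift T (int n) R \<in> I"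
      using common[of P Q R] by blast
    then show ?case using ord(3) 4 obj_le_shift_iff by blast
  next
    case (5 P Q)
    then obtain n where n: "shift T (int n) P \<in> I" "shift T (int n) Q \<in> I" using common[of P Q P] by blast
    then have Z: "Mor T (shift T (int n) Q) (shift T (int n) P) =
        {\<zero>\<^bsub>Hom T (shift T (int n) Q) (shift T (int n) P)\<^esub>}"
      using G1 5 obj_le_shift_iff isomorphic_shift_iff by blast
    have "f = \<zero>\<^bsub>Hom T Q P\<^esub>" if "f \<in> Mor T Q P" for f
      using shift_map_closed[OF that, of "int n"] Z shift_map_eq_zero_iff[OF that, of "int n"] by blast
    then show ?case by blast
  next
    case (6 P)
    then obtain n where "shift T (int n) P \<in> I" using common[of P P P] by blast
    then have "obj_le T (shift T (int n) P) (shift T (int n) (shift T 1 P))"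
      using G2[of "shift T (int n) P"] by (simp add: shift_shift add.commute)
    then show ?case using obj_le_shift_iff by blast
  next
    case (7 P Q)
    then obtain n where n: "shift T (int n) P \<in> I" "shift T (int n) Q \<in> I" using common[of P Q P] by blast
    have sh: "shift T 1 (shift T (int n) P) = shift T (int n) (shift T 1 P)"
      by (simp add: shift_shift add.commute)
    have "obj_le T (shift T (int n) P) (shift T (int n) Q)"
      "obj_le T (shift T (int n) Q) (shift T (int n) (shift T 1 P))"
      using 7 obj_le_shift by blast+
    then have "isomorphic T (shift T (int n) Q) (shift T (int n) P) \<or>
        isomorphic T (shift T (int n) Q) (shift T (int n) (shift T 1 P))"
      using G3[OF n] sh by simp
    then show ?case using isomorphic_shift_iff by blast
  next
    case (8 P Q R f g)
    then obtain n where "shift T (int n) P \<in> I" "shift T (int n) Q \<in> I" "shift T (int n) R \<in> I"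
      using common[of P Q R] by blast
    then have "shift_map T (int n) g \<cdot> shift_map T (int n) f \<noteq>
        \<zero>\<^bsub>Hom T (shift T (int n) P) (shift T (int n) R)\<^esub>"
      using linear_generator_cmp_nonzero[OF lin I] 8 shift_map_closed shift_map_eq_zero_iff by meson
    then show ?case using shift_map_cmp[of f P Q g R "int n"] 8 by auto
  qed
qed

end

context linearly_ordered_objects
begin

lemma le_antisym:
  assumes "P \<in> J" "Q \<in> J" "obj_le T P Q" "obj_le T Q P"
  shows "isomorphic T P Q"
proof (rule ccontr)
  assume "\<not> isomorphic T P Q"
  then have "Mor T P Q = {\<zero>\<^bsub>Hom T P Q\<^esub>}" using less_zero[of Q P] assms by blast
  then show False using assms(4) unfolding obj_le_iff by blast
qed

lemma not_le_zero:
  assumes "P \<in> J" "Q \<in> J" "\<not> obj_le T Q P"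
  shows "Mor T P Q = {\<zero>\<^bsub>Hom T P Q\<^esub>}"
proof (rule less_zero[OF assms(2,1)])
  show "obj_le T P Q" using le_total assms by blast
  show "\<not> isomorphic T P Q"
    using assms(1,3) le_refl obj_le_isomorphic isomorphic_refl by blast
qed

lemma shift_mono:
  assumes "P \<in> J" "m \<le> n"
  shows "obj_le T (shift T m P) (shift T n P)"
  using assms(2)
proof (induction n rule: int_ge_induct)
  case base
  then show ?case using assms(1) shift_closed le_refl by blast
next
  case (step n)
  have "obj_le T (shift T n P) (shift T (n + 1) P)"
    using le_shift_one[OF shift_closed[OF assms(1)], of n] by (simp add: shift_shift add.commute)
  then show ?case using step le_trans shift_closed[OF assms(1)] by blast
qed

text \<open>By the axiom on objects between \<open>P\<close> and \<open>P[1]\<close>, an object above \<open>P\<close> that is not isomorphic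
  to a shift of \<open>P\<close> lies above all shifts of \<open>P\<close>.\<close>

lemma le_imp_shift_le:
  assumes PQ: "P \<in> J" "Q \<in> J" and le: "obj_le T P Q" and ni: "\<And>n. \<not> isomorphic T (shift T n P) Q"
  shows "obj_le T (shift T n P) Q"
proof -
  have *: "obj_le T (shift T (int k) P) Q" for k
  proof (induction k)
    case 0
    then show ?case using le by (simp add: shift_zero)
  next
    case (Suc k)
    have "\<not> obj_le T Q (shift T 1 (shift T (int k) P))"
      using between_shifts[OF shift_closed[OF PQ(1)] PQ(2) Suc] ni isomorphic_sym
      by (metis shift_shift)
    then have "obj_le T (shift T 1 (shift T (int k) P)) Q" using le_total shift_closed PQ by blast
    then show ?case by (simp add: shift_shift)
  qed
  have "obj_le T (shift T n P) (shift T (int (nat n)) P)" by (rule shift_mono[OF PQ(1)]) simp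
  then show ?thesis using le_trans[OF shift_closed shift_closed PQ(2)] PQ(1) * by blast
qed

lemma shift_le_self_iff:
  assumes P: "P \<in> J"
  shows "obj_le T (shift T n P) P \<longleftrightarrow> n \<le> 0 \<or> \<not> obj_less T P (shift T 1 P)"
proof (cases "obj_less T P (shift T 1 P)")
  case True
  have "\<not> obj_le T (shift T n P) P" if "n > 0"
  proof
    assume n: "obj_le T (shift T n P) P"
    have "obj_le T (shift T 1 P) (shift T n P)" using shift_mono[OF P] that by simp
    then have "obj_le T (shift T 1 P) P" using le_trans shift_closed P n by blast
    then have "isomorphic T P (shift T 1 P)"
      using le_antisym[OF P shift_closed[OF P]] le_shift_one[OF P] by blast
    then show False using True by (simp add: obj_less_def)
  qed
  moreover have "obj_le T (shift T n P) P" if "n \<le> 0"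
    using shift_mono[OF P that] by (simp add: shift_zero)
  ultimately show ?thesis using True by force
next
  case False
  then have "isomorphic T P (shift T 1 P)" using le_shift_one[OF P] by (simp add: obj_less_def)
  then have le: "obj_le T (shift T 1 P) P"
    using obj_le_isomorphic[OF le_refl[OF P] _ isomorphic_refl] by blast
  have *: "obj_le T (shift T (int k) P) P" for k
  proof (induction k)
    case 0
    then show ?case using le_refl[OF P] by (simp add: shift_zero)
  next
    case (Suc k)
    have "obj_le T (shift T (int k) (shift T 1 P)) (shift T (int k) P)" using obj_le_shift[OF le] .
    then have "obj_le T (shift T (int (Suc k)) P) (shift T (int k) P)" by (simp add: shift_shift add.commute)
    then show ?case using Suc le_trans shift_closed P by blast
  qed
  have "obj_le T (shift T n P) (shift T (int (nat n)) P)" by (rule shift_mono[OF P]) simp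
  then show ?thesis using le_trans[OF shift_closed shift_closed P] P * False by blast
qed

lemma obj_less_shifts:
  assumes PQ: "P \<in> J" "Q \<in> J" and less: "obj_less T P Q" and ni: "\<And>n. \<not> isomorphic T (shift T n P) Q"
  shows "obj_le T (shift T n P) Q" and "\<not> obj_le T (shift T n Q) P"
proof -
  show le: "obj_le T (shift T n P) Q" for n
    using le_imp_shift_le[OF PQ] less ni by (simp add: obj_less_def)
  show "\<not> obj_le T (shift T n Q) P"
  proof
    assume "obj_le T (shift T n Q) P"
    then have "obj_le T Q (shift T (- n) P)" using obj_le_shift[of "shift T n Q" P "- n"] by simp
    then have "isomorphic T (shift T (- n) P) Q"
      using le_antisym[OF shift_closed[OF PQ(1)] PQ(2) le] by blast
    then show False using ni by blast
  qed
qed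

end


section \<open>Scalars attached to homogeneous morphisms\<close>

text \<open>A multiplicative choice of coordinates on the spaces of morphisms \<open>X \<rightarrow> Y[q]\<close> between
  objects of \<open>D\<close>: a faithful functor, linear on morphisms, from the graded category of \<open>D\<close> to the
  one-object category \<open>k\<close>.\<close>

definition scalar_functor ::
    "('k :: field, 'o, 'm) tricat \<Rightarrow> 'o set \<Rightarrow> ('o \<Rightarrow> 'o \<Rightarrow> int \<Rightarrow> 'm \<Rightarrow> 'k) \<Rightarrow> bool"
  where "scalar_functor T D \<kappa> \<longleftrightarrow>
    (\<forall>X\<in>D. \<forall>Y\<in>D. \<forall>q. \<forall>f\<in>Mor T X (shift T q Y).
      (\<forall>g\<in>Mor T X (shift T q Y). \<kappa> X Y q (f \<oplus>\<^bsub>Hom T X (shift T q Y)\<^esub> g) = \<kappa> X Y q f + \<kappa> X Y q g) \<and>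
      (\<forall>c. \<kappa> X Y q (c \<odot>\<^bsub>Hom T X (shift T q Y)\<^esub> f) = c * \<kappa> X Y q f) \<and>
      (\<kappa> X Y q f = 0 \<longrightarrow> f = \<zero>\<^bsub>Hom T X (shift T q Y)\<^esub>)) \<and>
    (\<forall>X\<in>D. \<kappa> X X 0 (ident T X) = 1) \<and>
    (\<forall>X\<in>D. \<forall>Y\<in>D. \<forall>Z\<in>D. \<forall>p q. \<forall>f\<in>Mor T X (shift T q Y). \<forall>g\<in>Mor T Y (shift T p Z).
      \<kappa> X Z (p + q) (shift_map T q g \<cdot>\<^bsub>T\<^esub> f) = \<kappa> Y Z p g * \<kappa> X Y q f)"

text \<open>Such coordinates exist if some object \<open>H\<close> lies below all objects of \<open>D\<close>.  Fix nonzero morphisms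
  \<open>x : H \<rightarrow> H[-1]\<close> and \<open>b\<^sub>X : X \<rightarrow> H\<close>.  Composing \<open>b\<^sub>X\<close> with \<open>p\<close> shifts of \<open>x\<close> gives a basis \<open>B X p\<close> of
  the one-dimensional space of morphisms \<open>X \<rightarrow> H[-p]\<close>, and \<open>f : X \<rightarrow> Y[q]\<close> sends \<open>B Y p\<close> to a
  multiple of \<open>B X (p - q)\<close>, whose coefficient does not depend on \<open>p\<close>.\<close>

lemma (in linearly_ordered_objects) scalar_functor_exists:
  assumes D: "D \<subseteq> J" and H: "H \<in> J" and min: "\<And>X. X \<in> D \<Longrightarrow> obj_le T H X"
  shows "\<exists>\<kappa>. scalar_functor T D \<kappa>"
proof -
  \<comment> \<open>the space of morphisms \<open>X \<rightarrow> H[n]\<close>, its zero and its scalar multiplication\<close>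
  define M where "M X n = Mor T X (shift T n H)" for X n
  define Z0 where "Z0 X n = \<zero>\<^bsub>Hom T X (shift T n H)\<^esub>" for X n
  define sc where "sc X n = module.smult (Hom T X (shift T n H))" for X n
  have le: "obj_le T (shift T n H) X" if "X \<in> D" "n \<le> 0" for X n
  proof -
    have "obj_le T (shift T n H) H" using shift_mono[OF H that(2)] by (simp add: shift_zero)
    then show ?thesis using le_trans[OF shift_closed[OF H] H _ _ min[OF that(1)]] D that(1) by blast
  qed
  have "obj_le T (shift T (- 1) H) H" using shift_mono[OF H, of "- 1" 0] by (simp add: shift_zero)
  then obtain x where x: "x \<in> Mor T H (shift T (- 1) H)" "x \<noteq> \<zero>\<^bsub>Hom T H (shift T (- 1) H)\<^esub>"
    unfolding obj_le_iff by blast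
  have "\<forall>X\<in>D. \<exists>b. b \<in> Mor T X H \<and> b \<noteq> \<zero>\<^bsub>Hom T X H\<^esub>"
    using min unfolding obj_le_iff by blast
  then obtain b where b: "\<And>X. X \<in> D \<Longrightarrow> b X \<in> Mor T X H" "\<And>X. X \<in> D \<Longrightarrow> b X \<noteq> \<zero>\<^bsub>Hom T X H\<^esub>"
    by metis
  define B where "B X = rec_nat (b X) (\<lambda>p h. shift_map T (- int p) x \<cdot> h)" for X
  have B0: "B X 0 = b X" and BS: "B X (Suc p) = shift_map T (- int p) x \<cdot> B X p" for X p
    by (simp_all add: B_def)
  have xs: "shift_map T n x \<in> Mor T (shift T n H) (shift T (n - 1) H)"
    "shift_map T n x \<noteq> \<zero>\<^bsub>Hom T (shift T n H) (shift T (n - 1) H)\<^esub>" for n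
    using shift_map_closed[OF x(1), of n] shift_map_eq_zero_iff[OF x(1), of n] x(2)
    by (simp_all add: shift_shift)
  have B: "B X p \<in> M X (- int p) \<and> B X p \<noteq> Z0 X (- int p)" if X: "X \<in> D" for X p
  proof (induction p)
    case 0
    then show ?case using b[OF X] by (simp add: B0 M_def Z0_def shift_zero)
  next
    case (Suc p)
    have e: "- int p - 1 = - int (Suc p)" by simp
    have BX: "B X p \<in> Mor T X (shift T (- int p) H)" "B X p \<noteq> \<zero>\<^bsub>Hom T X (shift T (- int p) H)\<^esub>"
      using Suc by (simp_all add: M_def Z0_def)
    have "X \<in> J" using X D by blast
    then show ?case
      using cmp_closed[OF BX(1) xs(1)] xs(2)
        cmp_nonzero[OF _ shift_closed[OF H] shift_closed[OF H] BX(1) xs(1) BX(2) xs(2)]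
      unfolding BS M_def Z0_def e by blast
  qed
  \<comment> \<open>\<open>P Y q p f\<close> is the pullback of \<open>B Y p\<close> along \<open>f : X \<rightarrow> Y[q]\<close>\<close>
  define P where "P Y q p f = shift_map T q (B Y p) \<cdot> f" for Y q p f
  have sB: "shift_map T q (B Y p) \<in> Mor T (shift T q Y) (shift T (q - int p) H)"
    "shift_map T q (B Y p) \<noteq> \<zero>\<^bsub>Hom T (shift T q Y) (shift T (q - int p) H)\<^esub>" if "Y \<in> D" for Y q p
    using B[OF that, of p] shift_map_closed[of "B Y p" Y "shift T (- int p) H" q]
      shift_map_eq_zero_iff[of "B Y p" Y "shift T (- int p) H" q]
    by (simp_all add: M_def Z0_def shift_shift)
  have P: "P Y q p f \<in> M X (q - int p)" if "Y \<in> D" "f \<in> Mor T X (shift T q Y)" for X Y q p f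
    unfolding P_def M_def using cmp_closed[OF that(2) sB(1)[OF that(1)]] .
  have BX: "B X (nat (int p - q)) \<in> M X (q - int p)" "B X (nat (int p - q)) \<noteq> Z0 X (q - int p)"
    if "X \<in> D" "q \<le> int p" for X p q
    using B[OF that(1), of "nat (int p - q)"] that(2) by simp_all
  have ex: "\<exists>c. P Y q p f = sc X (q - int p) c (B X (nat (int p - q)))"
    if "X \<in> D" "Y \<in> D" "f \<in> Mor T X (shift T q Y)" "q \<le> int p" for X Y q p f
    unfolding sc_def
    by (rule obj_le_scalar)
      (use le[OF that(1)] BX[OF that(1,4)] P[OF that(2,3)] that(4) in \<open>auto simp: M_def Z0_def\<close>)
  \<comment> \<open>\<open>nat q\<close> is the least \<open>p\<close> with \<open>p - q\<close> non-negative\<close>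
  define lam where
    "lam X Y q f = (SOME c. P Y q (nat q) f = sc X (q - int (nat q)) c (B X (nat (int (nat q) - q))))"
    for X Y q f
  have lam: "P Y q p f = sc X (q - int p) (lam X Y q f) (B X (nat (int p - q)))"
    if XY: "X \<in> D" "Y \<in> D" and f: "f \<in> Mor T X (shift T q Y)" and p: "q \<le> int p" for X Y q p f
  proof -
    have "nat q \<le> p" using p by simp
    then show ?thesis
    proof (induction p rule: dec_induct)
      case base
      show ?case unfolding lam_def by (rule someI_ex, rule ex[OF XY f]) simp
    next
      case (step p)
      let ?c = "lam X Y q f" and ?x = "shift_map T (q - int p) x"
      have qp: "q \<le> int p" using step(1) by simp
      have BY: "B Y p \<in> Mor T Y (shift T (- int p) H)" using B[OF XY(2)] by (simp add: M_def)
      have BX': "B X (nat (int p - q)) \<in> Mor T X (shift T (q - int p) H)"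
        using BX(1)[OF XY(1) qp] by (simp add: M_def)
      have n: "nat (int (Suc p) - q) = Suc (nat (int p - q))" "- int (nat (int p - q)) = q - int p"
        "q - int (Suc p) = q - int p - 1" using qp by auto
      have "shift_map T q (B Y (Suc p)) = ?x \<cdot> shift_map T q (B Y p)"
        using shift_map_cmp[OF BY xs(1), of q] shift_map_shift_map[OF x(1), of q "- int p"]
        by (simp add: BS)
      then have "P Y q (Suc p) f = ?x \<cdot> P Y q p f"
        unfolding P_def using cmp_assoc[OF f sB(1)[OF XY(2)] xs(1)] by simp
      also have "\<dots> = ?x \<cdot> sc X (q - int p) ?c (B X (nat (int p - q)))" using step(3) by simp
      also have "\<dots> = sc X (q - int (Suc p)) ?c (B X (nat (int (Suc p) - q)))"
        unfolding n(1) BS n(2) n(3) unfolding sc_def using cmp_smult_right[OF BX' xs(1)] .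
      finally show ?case .
    qed
  qed
  have lam_eqI: "lam X Y q f = c"
    if "X \<in> D" "Y \<in> D" "f \<in> Mor T X (shift T q Y)" "q \<le> int p"
      "P Y q p f = sc X (q - int p) c (B X (nat (int p - q)))" for X Y q p f c
    by (rule smult_cancel[of "B X (nat (int p - q))" X "shift T (q - int p) H"])
      (use lam[OF that(1-4)] that(5) BX[OF that(1,4)] in \<open>simp_all add: M_def Z0_def sc_def\<close>)
  have "scalar_functor T D lam"
    unfolding scalar_functor_def
  proof (intro conjI ballI allI impI)
    fix X Y q f g
    assume XY: "X \<in> D" "Y \<in> D" and f: "f \<in> Mor T X (shift T q Y)" and g: "g \<in> Mor T X (shift T q Y)"
    have q: "q \<le> int (nat q)" by simp
    note B' = BX(1)[OF XY(1) q, unfolded M_def]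
    show "lam X Y q (f \<oplus>\<^bsub>Hom T X (shift T q Y)\<^esub> g) = lam X Y q f + lam X Y q g"
    proof (rule lam_eqI[OF XY _ q])
      have "P Y q (nat q) (f \<oplus>\<^bsub>Hom T X (shift T q Y)\<^esub> g) =
          P Y q (nat q) f \<oplus>\<^bsub>Hom T X (shift T (q - int (nat q)) H)\<^esub> P Y q (nat q) g"
        unfolding P_def by (rule cmp_add_right[OF f g sB(1)[OF XY(2)]])
      then show "P Y q (nat q) (f \<oplus>\<^bsub>Hom T X (shift T q Y)\<^esub> g) =
          sc X (q - int (nat q)) (lam X Y q f + lam X Y q g) (B X (nat (int (nat q) - q)))"
        unfolding lam[OF XY f q] lam[OF XY g q] sc_def using smult_add_left[OF B'] by simp
    qed (use f g in simp)
  next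
    fix X Y q f c
    assume XY: "X \<in> D" "Y \<in> D" and f: "f \<in> Mor T X (shift T q Y)"
    have q: "q \<le> int (nat q)" by simp
    note B' = BX(1)[OF XY(1) q, unfolded M_def]
    show "lam X Y q (c \<odot>\<^bsub>Hom T X (shift T q Y)\<^esub> f) = c * lam X Y q f"
    proof (rule lam_eqI[OF XY _ q])
      have "P Y q (nat q) (c \<odot>\<^bsub>Hom T X (shift T q Y)\<^esub> f) = sc X (q - int (nat q)) c (P Y q (nat q) f)"
        unfolding P_def sc_def by (rule cmp_smult_right[OF f sB(1)[OF XY(2)]])
      then show "P Y q (nat q) (c \<odot>\<^bsub>Hom T X (shift T q Y)\<^esub> f) =
          sc X (q - int (nat q)) (c * lam X Y q f) (B X (nat (int (nat q) - q)))"
        unfolding lam[OF XY f q] sc_def using smult_smult[OF B'] by simp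
    qed (use f in simp)
  next
    fix X Y q f
    assume XY: "X \<in> D" "Y \<in> D" and f: "f \<in> Mor T X (shift T q Y)" and z: "lam X Y q f = 0"
    have q: "q \<le> int (nat q)" by simp
    note B' = BX(1)[OF XY(1) q, unfolded M_def]
    have "P Y q (nat q) f = \<zero>\<^bsub>Hom T X (shift T (q - int (nat q)) H)\<^esub>"
      using lam[OF XY f q] B' unfolding z sc_def by simp
    moreover have "X \<in> J" "Y \<in> J" using XY D by auto
    ultimately show "f = \<zero>\<^bsub>Hom T X (shift T q Y)\<^esub>"
      using cmp_nonzero[OF _ shift_closed shift_closed[OF H] f sB(1)[OF XY(2)] _ sB(2)[OF XY(2)]]
      unfolding P_def by blast
  next
    fix X assume X: "X \<in> D"
    have bX: "b X \<in> Mor T X H" using b X by blast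
    show "lam X X 0 (ident T X) = 1"
    proof (rule lam_eqI[OF X X, of _ _ 0])
      show "P X 0 0 (ident T X) = sc X (0 - int 0) 1 (B X (nat (int 0 - 0)))"
        using bX by (simp add: P_def B0 sc_def shift_map_zero[OF bX] cmp_ident_right[OF bX] shift_zero)
    qed (use ident_closed in \<open>simp_all add: shift_zero\<close>)
  next
    fix X Y Z p q f g
    assume XYZ: "X \<in> D" "Y \<in> D" "Z \<in> D"
      and f: "f \<in> Mor T X (shift T q Y)" and g: "g \<in> Mor T Y (shift T p Z)"
    \<comment> \<open>\<open>r\<close> is so large that the basis elements \<open>B Z r\<close>, \<open>B Y s\<close> and \<open>B X (s - q)\<close> all exist\<close>
    define r where "r = nat (\<bar>p\<bar> + \<bar>q\<bar>)"
    define s where "s = nat (int r - p)"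
    have rs: "p \<le> int r" "p + q \<le> int r" "q \<le> int s" "int s = int r - p" unfolding r_def s_def by auto
    have n: "nat (int r - p) = s" "nat (int s - q) = nat (int r - (p + q))"
      "q - int s = p + q - int r" using rs by auto
    have sg: "shift_map T q g \<in> Mor T (shift T q Y) (shift T (p + q) Z)"
      using shift_map_closed[OF g, of q] by (simp add: shift_shift add.commute)
    have BZ: "B Z r \<in> Mor T Z (shift T (- int r) H)" using B[OF XYZ(3)] by (simp add: M_def)
    have BY: "B Y s \<in> Mor T Y (shift T (p - int r) H)" using B[OF XYZ(2), of s] rs(4) by (simp add: M_def)
    have BX': "B X (nat (int s - q)) \<in> Mor T X (shift T (q - int s) H)"
      using BX(1)[OF XYZ(1) rs(3)] by (simp add: M_def)
    have Pg: "P Z p r g \<in> Mor T Y (shift T (p - int r) H)" using P[OF XYZ(3) g] by (simp add: M_def)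
    have tgt: "shift T q (shift T (p - int r) H) = shift T (q - int s) H"
    proof -
      have "q + (p - int r) = q - int s" using rs(4) by simp
      then show ?thesis by (simp only: shift_shift)
    qed
    show "lam X Z (p + q) (shift_map T q g \<cdot> f) = lam Y Z p g * lam X Y q f"
    proof (rule lam_eqI[OF XYZ(1,3) cmp_closed[OF f sg] rs(2)])
      have "P Z (p + q) r (shift_map T q g \<cdot> f) = (shift_map T (p + q) (B Z r) \<cdot> shift_map T q g) \<cdot> f"
        unfolding P_def by (rule cmp_assoc[OF f sg sB(1)[OF XYZ(3)]])
      also have "shift_map T (p + q) (B Z r) \<cdot> shift_map T q g = shift_map T q (P Z p r g)"
        using shift_map_cmp[OF g sB(1)[OF XYZ(3)], of q r] shift_map_shift_map[OF BZ, of q p]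
        by (simp add: P_def add.commute)
      also have "P Z p r g = sc Y (p - int r) (lam Y Z p g) (B Y s)"
        using lam[OF XYZ(2,3) g rs(1)] n(1) by simp
      also have "shift_map T q \<dots> = lam Y Z p g \<odot>\<^bsub>Hom T (shift T q Y) (shift T (q - int s) H)\<^esub> shift_map T q (B Y s)"
        unfolding sc_def using shift_map_smult[OF BY, of q "lam Y Z p g"] tgt by simp
      also have "\<dots> \<cdot> f = sc X (q - int s) (lam Y Z p g) (P Y q s f)"
        unfolding P_def sc_def by (rule cmp_smult_left[OF f sB(1)[OF XYZ(2)]])
      also have "\<dots> = sc X (q - int s) (lam Y Z p g * lam X Y q f) (B X (nat (int s - q)))"
        unfolding lam[OF XYZ(1,2) f rs(3)] sc_def using smult_smult[OF BX'] .
      finally show "P Z (p + q) r (shift_map T q g \<cdot> f) =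
          sc X (p + q - int r) (lam Y Z p g * lam X Y q f) (B X (nat (int r - (p + q))))"
        unfolding n .
    qed
  qed
  then show ?thesis by (intro exI)
qed


section \<open>Matrix coordinates of graded endomorphisms\<close>

context linear_category
begin

lemma sum_cmp_inc:
  fixes n :: nat
  assumes r: "\<And>k. k < n \<Longrightarrow> r k \<in> Mor T (Y k) Z"
    and prj: "\<And>k. k < n \<Longrightarrow> prj k \<in> Mor T X (Y k)" and inc: "\<And>k. k < n \<Longrightarrow> inc k \<in> Mor T (Y k) X"
    and pi: "\<And>k l. \<lbrakk>k < n; l < n\<rbrakk> \<Longrightarrow>
      prj k \<cdot> inc l = (if k = l then ident T (Y k) else \<zero>\<^bsub>Hom T (Y l) (Y k)\<^esub>)"
    and j: "j < n"
  shows "finsum (Hom T X Z) (\<lambda>k. r k \<cdot> prj k) {..<n} \<cdot> inc j = r j"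
proof -
  have "finsum (Hom T X Z) (\<lambda>k. r k \<cdot> prj k) {..<n} \<cdot> inc j =
      finsum (Hom T (Y j) Z) (\<lambda>k. (r k \<cdot> prj k) \<cdot> inc j) {..<n}"
    by (rule cmp_finsum_left) (auto intro!: cmp_closed intro: r prj inc j)
  also have "\<dots> = finsum (Hom T (Y j) Z) (\<lambda>k. if k = j then r k else \<zero>\<^bsub>Hom T (Y j) Z\<^esub>) {..<n}"
  proof (rule Hom.finsum_cong')
    fix k assume "k \<in> {..<n}"
    then have k: "k < n" by simp
    have "(r k \<cdot> prj k) \<cdot> inc j = r k \<cdot> (prj k \<cdot> inc j)"
      using cmp_assoc[OF inc[OF j] prj[OF k] r[OF k]] by simp
    then show "(r k \<cdot> prj k) \<cdot> inc j = (if k = j then r k else \<zero>\<^bsub>Hom T (Y j) Z\<^esub>)"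
      using pi[OF k j] cmp_ident_right[OF r[OF k]] cmp_zero_right[OF r[OF k], of "Y j"] by auto
  qed (auto intro: r)
  also have "\<dots> = r j" using j by (intro finsum_delta) (auto intro: r)
  finally show ?thesis .
qed

lemma prj_cmp_sum:
  fixes n :: nat
  assumes r: "\<And>k. k < n \<Longrightarrow> r k \<in> Mor T Z (Y k)"
    and prj: "\<And>k. k < n \<Longrightarrow> prj k \<in> Mor T X (Y k)" and inc: "\<And>k. k < n \<Longrightarrow> inc k \<in> Mor T (Y k) X"
    and pi: "\<And>k l. \<lbrakk>k < n; l < n\<rbrakk> \<Longrightarrow>
      prj k \<cdot> inc l = (if k = l then ident T (Y k) else \<zero>\<^bsub>Hom T (Y l) (Y k)\<^esub>)"
    and j: "j < n"
  shows "prj j \<cdot> finsum (Hom T Z X) (\<lambda>k. inc k \<cdot> r k) {..<n} = r j"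
proof -
  have "prj j \<cdot> finsum (Hom T Z X) (\<lambda>k. inc k \<cdot> r k) {..<n} =
      finsum (Hom T Z (Y j)) (\<lambda>k. prj j \<cdot> (inc k \<cdot> r k)) {..<n}"
    by (rule cmp_finsum_right) (auto intro!: cmp_closed intro: r prj inc j)
  also have "\<dots> = finsum (Hom T Z (Y j)) (\<lambda>k. if k = j then r k else \<zero>\<^bsub>Hom T Z (Y j)\<^esub>) {..<n}"
  proof (rule Hom.finsum_cong')
    fix k assume "k \<in> {..<n}"
    then have k: "k < n" by simp
    show "prj j \<cdot> (inc k \<cdot> r k) = (if k = j then r k else \<zero>\<^bsub>Hom T Z (Y j)\<^esub>)"
      using cmp_assoc[OF r[OF k] inc[OF k] prj[OF j]] pi[OF j k] cmp_ident_left[OF r[OF k]]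
        cmp_zero_left[OF r[OF k], of "Y j"] by auto
  qed (auto intro: r)
  also have "\<dots> = r j" using j by (intro finsum_delta) (auto intro: r)
  finally show ?thesis .
qed

lemma cmp_inc_zero_imp_zero:
  fixes n :: nat
  assumes f: "f \<in> Mor T X Z"
    and prj: "\<And>k. k < n \<Longrightarrow> prj k \<in> Mor T X (Y k)" and inc: "\<And>k. k < n \<Longrightarrow> inc k \<in> Mor T (Y k) X"
    and sm: "finsum (Hom T X X) (\<lambda>k. inc k \<cdot> prj k) {..<n} = ident T X"
    and z: "\<And>k. k < n \<Longrightarrow> f \<cdot> inc k = \<zero>\<^bsub>Hom T (Y k) Z\<^esub>"
  shows "f = \<zero>\<^bsub>Hom T X Z\<^esub>"
proof -
  have "f = f \<cdot> finsum (Hom T X X) (\<lambda>k. inc k \<cdot> prj k) {..<n}"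
    using sm cmp_ident_right[OF f] by simp
  also have "\<dots> = finsum (Hom T X Z) (\<lambda>k. f \<cdot> (inc k \<cdot> prj k)) {..<n}"
    by (rule cmp_finsum_right) (auto intro!: cmp_closed intro: prj inc f)
  also have "\<dots> = finsum (Hom T X Z) (\<lambda>k. \<zero>\<^bsub>Hom T X Z\<^esub>) {..<n}"
  proof (rule Hom.finsum_cong')
    fix k assume "k \<in> {..<n}"
    then have k: "k < n" by simp
    show "f \<cdot> (inc k \<cdot> prj k) = \<zero>\<^bsub>Hom T X Z\<^esub>"
      using cmp_assoc[OF prj[OF k] inc[OF k] f] z[OF k] cmp_zero_left[OF prj[OF k], of Z] by simp
  qed auto
  finally show ?thesis by (simp add: Hom.finsum_zero)
qed

lemma prj_cmp_zero_imp_zero: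
  fixes n :: nat
  assumes f: "f \<in> Mor T Z X"
    and prj: "\<And>k. k < n \<Longrightarrow> prj k \<in> Mor T X (Y k)" and inc: "\<And>k. k < n \<Longrightarrow> inc k \<in> Mor T (Y k) X"
    and sm: "finsum (Hom T X X) (\<lambda>k. inc k \<cdot> prj k) {..<n} = ident T X"
    and z: "\<And>k. k < n \<Longrightarrow> prj k \<cdot> f = \<zero>\<^bsub>Hom T Z (Y k)\<^esub>"
  shows "f = \<zero>\<^bsub>Hom T Z X\<^esub>"
proof -
  have "f = finsum (Hom T X X) (\<lambda>k. inc k \<cdot> prj k) {..<n} \<cdot> f"
    using sm cmp_ident_left[OF f] by simp
  also have "\<dots> = finsum (Hom T Z X) (\<lambda>k. (inc k \<cdot> prj k) \<cdot> f) {..<n}"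
    by (rule cmp_finsum_left) (auto intro!: cmp_closed intro: prj inc f)
  also have "\<dots> = finsum (Hom T Z X) (\<lambda>k. \<zero>\<^bsub>Hom T Z X\<^esub>) {..<n}"
  proof (rule Hom.finsum_cong')
    fix k assume "k \<in> {..<n}"
    then have k: "k < n" by simp
    show "(inc k \<cdot> prj k) \<cdot> f = \<zero>\<^bsub>Hom T Z X\<^esub>"
      using cmp_assoc[OF f prj[OF k] inc[OF k]] z[OF k] cmp_zero_right[OF inc[OF k], of Z] by simp
  qed auto
  finally show ?thesis by (simp add: Hom.finsum_zero)
qed

lemma additive_finsum:
  fixes h :: "'m \<Rightarrow> 'a :: comm_monoid_add"
  assumes add: "\<And>f g. \<lbrakk>f \<in> Mor T X Y; g \<in> Mor T X Y\<rbrakk> \<Longrightarrow> h (f \<oplus>\<^bsub>Hom T X Y\<^esub> g) = h f + h g"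
    and zero: "h \<zero>\<^bsub>Hom T X Y\<^esub> = 0"
    and A: "finite A" "\<And>i. i \<in> A \<Longrightarrow> f i \<in> Mor T X Y"
  shows "h (finsum (Hom T X Y) f A) = (\<Sum>i\<in>A. h (f i))"
  using A
proof (induction A rule: finite_induct)
  case empty
  then show ?case by (simp add: zero)
next
  case (insert a A)
  then show ?case by (simp add: Pi_def add Hom.finsum_closed)
qed

end

text \<open>A presentation of the graded endomorphisms of \<open>G\<close> by \<open>m \<times> m\<close> matrices: \<open>C l j n f\<close> is the
  entry at \<open>(l, j)\<close> of the matrix of \<open>f : G \<rightarrow> G[n]\<close>, and \<open>S l j n\<close> says at which positions the
  matrices of degree \<open>n\<close> may be nonzero.\<close>

locale matrix_coordinates = triangulated_category +
  fixes G :: 'b and m :: nat and S :: "nat \<Rightarrow> nat \<Rightarrow> int \<Rightarrow> bool"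
    and C :: "nat \<Rightarrow> nat \<Rightarrow> int \<Rightarrow> 'c \<Rightarrow> 'a"
  assumes C_add: "\<lbrakk>l < m; j < m; f \<in> Mor T G (shift T n G); g \<in> Mor T G (shift T n G)\<rbrakk> \<Longrightarrow>
      C l j n (f \<oplus>\<^bsub>Hom T G (shift T n G)\<^esub> g) = C l j n f + C l j n g"
    and C_smult: "\<lbrakk>l < m; j < m; f \<in> Mor T G (shift T n G)\<rbrakk> \<Longrightarrow>
      C l j n (c \<odot>\<^bsub>Hom T G (shift T n G)\<^esub> f) = c * C l j n f"
    and C_support: "\<lbrakk>l < m; j < m; f \<in> Mor T G (shift T n G); C l j n f \<noteq> 0\<rbrakk> \<Longrightarrow> S l j n"
    and C_faithful: "\<lbrakk>f \<in> Mor T G (shift T n G); \<And>l j. \<lbrakk>l < m; j < m\<rbrakk> \<Longrightarrow> C l j n f = 0\<rbrakk> \<Longrightarrow>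
      f = \<zero>\<^bsub>Hom T G (shift T n G)\<^esub>"
    and C_full: "(\<And>l j. \<lbrakk>l < m; j < m; a l j \<noteq> 0\<rbrakk> \<Longrightarrow> S l j n) \<Longrightarrow>
      \<exists>f\<in>Mor T G (shift T n G). \<forall>l<m. \<forall>j<m. C l j n f = a l j"
    and C_ident: "\<lbrakk>l < m; j < m\<rbrakk> \<Longrightarrow> C l j 0 (ident T G) = (if l = j then 1 else 0)"
    and C_cmp: "\<lbrakk>l < m; j < m; f \<in> Mor T G (shift T q G); g \<in> Mor T G (shift T p G)\<rbrakk> \<Longrightarrow>
      C l j (p + q) (shift_map T q g \<cdot> f) = (\<Sum>t<m. C l t p g * C t j q f)"

text \<open>The entries of \<open>f : G \<rightarrow> G[n]\<close> with respect to a decomposition of \<open>G\<close>, turned into scalars.\<close>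

lemma (in triangulated_category) matrix_coordinates_exist:
  assumes sum: "is_direct_sum T G Hs" and \<kappa>: "scalar_functor T (set Hs) \<kappa>"
    and dich: "\<And>P Q n. \<lbrakk>P \<in> set Hs; Q \<in> set Hs; \<not> obj_le T (shift T n Q) P\<rbrakk> \<Longrightarrow>
      Mor T P (shift T n Q) = {\<zero>\<^bsub>Hom T P (shift T n Q)\<^esub>}"
  shows "\<exists>C. matrix_coordinates T G (length Hs) (\<lambda>l j n. obj_le T (shift T n (Hs ! l)) (Hs ! j)) C"
proof -
  let ?m = "length Hs"
  obtain inc prj where inc: "\<And>k. k < ?m \<Longrightarrow> inc k \<in> Mor T (Hs ! k) G"
    and prj: "\<And>k. k < ?m \<Longrightarrow> prj k \<in> Mor T G (Hs ! k)"
    and pi: "\<And>k l. \<lbrakk>k < ?m; l < ?m\<rbrakk> \<Longrightarrow>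
      prj k \<cdot> inc l = (if k = l then ident T (Hs ! k) else \<zero>\<^bsub>Hom T (Hs ! l) (Hs ! k)\<^esub>)"
    and sm: "finsum (Hom T G G) (\<lambda>k. inc k \<cdot> prj k) {..<?m} = ident T G"
    by (rule is_direct_sumE[OF sum]) (rule that)
  define si where "si n k = shift_map T n (inc k)" for n k
  define sp where "sp n k = shift_map T n (prj k)" for n k
  have si: "si n k \<in> Mor T (shift T n (Hs ! k)) (shift T n G)"
    and sp: "sp n k \<in> Mor T (shift T n G) (shift T n (Hs ! k))" if "k < ?m" for n k
    unfolding si_def sp_def using that inc prj shift_map_closed by blast+
  have spi: "sp n k \<cdot> si n l = (if k = l then ident T (shift T n (Hs ! k))
      else \<zero>\<^bsub>Hom T (shift T n (Hs ! l)) (shift T n (Hs ! k))\<^esub>)" if "k < ?m" "l < ?m" for n k l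
    unfolding si_def sp_def
    using shift_map_cmp[OF inc[OF that(2)] prj[OF that(1)], of n] pi[OF that]
    by (auto simp: shift_map_ident)
  have ssm: "finsum (Hom T (shift T n G) (shift T n G)) (\<lambda>k. si n k \<cdot> sp n k) {..<?m} =
      ident T (shift T n G)" for n
  proof -
    have "ident T (shift T n G) = shift_map T n (finsum (Hom T G G) (\<lambda>k. inc k \<cdot> prj k) {..<?m})"
      by (simp add: sm shift_map_ident)
    also have "\<dots> = finsum (Hom T (shift T n G) (shift T n G)) (\<lambda>k. shift_map T n (inc k \<cdot> prj k)) {..<?m}"
      by (rule shift_map_finsum) (auto intro!: cmp_closed intro: inc prj)
    also have "\<dots> = finsum (Hom T (shift T n G) (shift T n G)) (\<lambda>k. si n k \<cdot> sp n k) {..<?m}"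
    proof (rule Hom.finsum_cong')
      fix k assume "k \<in> {..<?m}"
      then have k: "k < ?m" by simp
      show "shift_map T n (inc k \<cdot> prj k) = si n k \<cdot> sp n k"
        unfolding si_def sp_def by (rule shift_map_cmp[OF prj[OF k] inc[OF k]])
    qed (auto intro!: cmp_closed intro: si sp)
    finally show ?thesis by simp
  qed
  have \<kappa>_add: "\<kappa> X Y q (f \<oplus>\<^bsub>Hom T X (shift T q Y)\<^esub> g) = \<kappa> X Y q f + \<kappa> X Y q g"
    and \<kappa>_smult: "\<kappa> X Y q (c \<odot>\<^bsub>Hom T X (shift T q Y)\<^esub> f) = c * \<kappa> X Y q f"
    and \<kappa>_inj: "\<kappa> X Y q f = 0 \<Longrightarrow> f = \<zero>\<^bsub>Hom T X (shift T q Y)\<^esub>"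
    if "X \<in> set Hs" "Y \<in> set Hs" "f \<in> Mor T X (shift T q Y)" "g \<in> Mor T X (shift T q Y)" for X Y q f g c
    using \<kappa> that unfolding scalar_functor_def by blast+
  have \<kappa>_ident: "\<kappa> X X 0 (ident T X) = 1" if "X \<in> set Hs" for X
    using \<kappa> that unfolding scalar_functor_def by blast
  have \<kappa>_cmp: "\<kappa> X Z (p + q) (shift_map T q g \<cdot> f) = \<kappa> Y Z p g * \<kappa> X Y q f"
    if "X \<in> set Hs" "Y \<in> set Hs" "Z \<in> set Hs" "f \<in> Mor T X (shift T q Y)" "g \<in> Mor T Y (shift T p Z)"
    for X Y Z p q f g
    using \<kappa> that unfolding scalar_functor_def by blast
  have \<kappa>_zero: "\<kappa> X Y q \<zero>\<^bsub>Hom T X (shift T q Y)\<^esub> = 0" if "X \<in> set Hs" "Y \<in> set Hs" for X Y q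
    using \<kappa>_smult[OF that, of "\<zero>\<^bsub>Hom T X (shift T q Y)\<^esub>" q "\<zero>\<^bsub>Hom T X (shift T q Y)\<^esub>" 0] by simp
  define en where "en l j n f = (sp n l \<cdot> f) \<cdot> inc j" for l j n f
  define C where "C l j n f = \<kappa> (Hs ! j) (Hs ! l) n (en l j n f)" for l j n f
  have en: "en l j n f \<in> Mor T (Hs ! j) (shift T n (Hs ! l))"
    if "l < ?m" "j < ?m" "f \<in> Mor T G (shift T n G)" for l j n f
    unfolding en_def using cmp_closed[OF inc[OF that(2)] cmp_closed[OF that(3) sp[OF that(1)]]] .
  have "matrix_coordinates T G ?m (\<lambda>l j n. obj_le T (shift T n (Hs ! l)) (Hs ! j)) C"
  proof (unfold_locales, goal_cases)
    case (1 l j f n g)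
    have "en l j n (f \<oplus>\<^bsub>Hom T G (shift T n G)\<^esub> g) =
        en l j n f \<oplus>\<^bsub>Hom T (Hs ! j) (shift T n (Hs ! l))\<^esub> en l j n g"
      unfolding en_def cmp_add_right[OF 1(3,4) sp[OF 1(1)]]
      by (rule cmp_add_left[OF inc[OF 1(2)] cmp_closed[OF 1(3) sp[OF 1(1)]] cmp_closed[OF 1(4) sp[OF 1(1)]]])
    then show ?case
      unfolding C_def using \<kappa>_add[OF _ _ en[OF 1(1,2,3)] en[OF 1(1,2,4)]] 1(1,2) by simp
  next
    case (2 l j f n c)
    have "en l j n (c \<odot>\<^bsub>Hom T G (shift T n G)\<^esub> f) = c \<odot>\<^bsub>Hom T (Hs ! j) (shift T n (Hs ! l))\<^esub> en l j n f"
      unfolding en_def cmp_smult_right[OF 2(3) sp[OF 2(1)]]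
      by (rule cmp_smult_left[OF inc[OF 2(2)] cmp_closed[OF 2(3) sp[OF 2(1)]]])
    then show ?case
      unfolding C_def using \<kappa>_smult[OF _ _ en[OF 2(1,2,3)] en[OF 2(1,2,3)]] 2(1,2) by simp
  next
    case (3 l j f n)
    show ?case
    proof (rule ccontr)
      assume "\<not> obj_le T (shift T n (Hs ! l)) (Hs ! j)"
      then have "en l j n f = \<zero>\<^bsub>Hom T (Hs ! j) (shift T n (Hs ! l))\<^esub>"
        using dich[of "Hs ! j" "Hs ! l" n] en[OF 3(1,2,3)] 3(1,2) by auto
      then show False using 3 \<kappa>_zero[of "Hs ! j" "Hs ! l" n] by (simp add: C_def)
    qed
  next
    case (4 f n)
    have z: "en l j n f = \<zero>\<^bsub>Hom T (Hs ! j) (shift T n (Hs ! l))\<^esub>" if "l < ?m" "j < ?m" for l j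
      using 4(2)[OF that] \<kappa>_inj[OF _ _ en[OF that 4(1)] en[OF that 4(1)]] that by (simp add: C_def)
    have "sp n l \<cdot> f = \<zero>\<^bsub>Hom T G (shift T n (Hs ! l))\<^esub>" if l: "l < ?m" for l
      by (rule cmp_inc_zero_imp_zero[OF cmp_closed[OF 4(1) sp[OF l]] prj inc sm])
        (use z[OF l] in \<open>simp_all add: en_def\<close>)
    then show ?case by (intro prj_cmp_zero_imp_zero[OF 4(1) sp si ssm]) simp_all
  next
    case (5 a n)
    have "\<exists>e\<in>Mor T (Hs ! j) (shift T n (Hs ! l)). \<kappa> (Hs ! j) (Hs ! l) n e = a l j"
      if lj: "l < ?m" "j < ?m" for l j
    proof (cases "a l j = 0")
      case True
      then show ?thesis
        using \<kappa>_zero[of "Hs ! j" "Hs ! l" n] lj by (intro bexI[of _ "\<zero>\<^bsub>Hom T (Hs ! j) (shift T n (Hs ! l))\<^esub>"]) auto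
    next
      case False
      then obtain e where e: "e \<in> Mor T (Hs ! j) (shift T n (Hs ! l))"
        "e \<noteq> \<zero>\<^bsub>Hom T (Hs ! j) (shift T n (Hs ! l))\<^esub>"
        using 5 lj unfolding obj_le_iff by blast
      let ?k = "\<kappa> (Hs ! j) (Hs ! l) n e"
      have "?k \<noteq> 0" using \<kappa>_inj[OF _ _ e(1) e(1)] e(2) lj by auto
      then have "\<kappa> (Hs ! j) (Hs ! l) n ((a l j / ?k) \<odot>\<^bsub>Hom T (Hs ! j) (shift T n (Hs ! l))\<^esub> e) = a l j"
        using \<kappa>_smult[OF _ _ e(1) e(1)] lj by simp
      then show ?thesis using e(1) smult_closed by blast
    qed
    then obtain e where e: "\<And>l j. \<lbrakk>l < ?m; j < ?m\<rbrakk> \<Longrightarrow> e l j \<in> Mor T (Hs ! j) (shift T n (Hs ! l))"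
      "\<And>l j. \<lbrakk>l < ?m; j < ?m\<rbrakk> \<Longrightarrow> \<kappa> (Hs ! j) (Hs ! l) n (e l j) = a l j"
      by metis
    define r where "r j = finsum (Hom T (Hs ! j) (shift T n G)) (\<lambda>l. si n l \<cdot> e l j) {..<?m}" for j
    define f where "f = finsum (Hom T G (shift T n G)) (\<lambda>j. r j \<cdot> prj j) {..<?m}"
    have r: "r j \<in> Mor T (Hs ! j) (shift T n G)" if "j < ?m" for j
      unfolding r_def by (auto intro!: Hom.finsum_closed cmp_closed intro: si e(1) that)
    have f: "f \<in> Mor T G (shift T n G)"
      unfolding f_def by (auto intro!: Hom.finsum_closed cmp_closed intro: r prj)
    have "en l j n f = e l j" if lj: "l < ?m" "j < ?m" for l j
    proof -
      have "en l j n f = sp n l \<cdot> (f \<cdot> inc j)"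
        unfolding en_def by (rule cmp_assoc[OF inc[OF lj(2)] f sp[OF lj(1)], symmetric])
      also have "f \<cdot> inc j = r j" unfolding f_def by (rule sum_cmp_inc[OF r prj inc pi lj(2)])
      also have "sp n l \<cdot> r j = e l j"
        unfolding r_def by (rule prj_cmp_sum[OF e(1)[OF _ lj(2)] sp si spi lj(1)])
      finally show ?thesis .
    qed
    then show ?case using f e(2) by (intro bexI[of _ f]) (auto simp: C_def)
  next
    case (6 l j)
    have "en l j 0 (ident T G) = prj l \<cdot> inc j"
      using cmp_ident_right[OF prj[OF 6(1)]] by (simp add: en_def sp_def shift_map_zero[OF prj[OF 6(1)]])
    then show ?case
      using pi[OF 6] \<kappa>_ident[of "Hs ! j"] \<kappa>_zero[of "Hs ! j" "Hs ! l" 0] 6 by (simp add: C_def shift_zero)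
  next
    case (7 l j f q g p)
    let ?A = "shift_map T q (sp p l \<cdot> g)" and ?B = "f \<cdot> inc j"
    have A: "?A \<in> Mor T (shift T q G) (shift T (p + q) (Hs ! l))"
      using shift_map_closed[OF cmp_closed[OF 7(4) sp[OF 7(1)]], of q]
      by (simp add: shift_shift add.commute)
    have B: "?B \<in> Mor T (Hs ! j) (shift T q G)" using cmp_closed[OF inc[OF 7(2)] 7(3)] .
    have sg: "shift_map T q g \<in> Mor T (shift T q G) (shift T (p + q) G)"
      using shift_map_closed[OF 7(4), of q] by (simp add: shift_shift add.commute)
    have "en l j (p + q) (shift_map T q g \<cdot> f) = (sp (p + q) l \<cdot> shift_map T q g) \<cdot> ?B"
      unfolding en_def
      using cmp_assoc[OF 7(3) sg sp[OF 7(1)]] cmp_assoc[OF inc[OF 7(2)] 7(3) cmp_closed[OF sg sp[OF 7(1)]]]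
      by simp
    also have "sp (p + q) l \<cdot> shift_map T q g = ?A"
      using shift_map_cmp[OF 7(4) sp[OF 7(1)], of q] shift_map_shift_map[OF prj[OF 7(1)], of q p]
      by (simp add: sp_def add.commute)
    also have "?A \<cdot> ?B = ?A \<cdot> (finsum (Hom T (shift T q G) (shift T q G)) (\<lambda>t. si q t \<cdot> sp q t) {..<?m} \<cdot> ?B)"
      unfolding ssm cmp_ident_left[OF B] ..
    also have "finsum (Hom T (shift T q G) (shift T q G)) (\<lambda>t. si q t \<cdot> sp q t) {..<?m} \<cdot> ?B =
        finsum (Hom T (Hs ! j) (shift T q G)) (\<lambda>t. (si q t \<cdot> sp q t) \<cdot> ?B) {..<?m}"
      by (rule cmp_finsum_left) (auto intro!: cmp_closed B intro: si sp)
    also have "?A \<cdot> \<dots> = finsum (Hom T (Hs ! j) (shift T (p + q) (Hs ! l)))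
        (\<lambda>t. ?A \<cdot> ((si q t \<cdot> sp q t) \<cdot> ?B)) {..<?m}"
      by (rule cmp_finsum_right[OF _ _ A]) (auto intro!: cmp_closed[OF B] cmp_closed intro: si sp)
    also have "\<dots> = finsum (Hom T (Hs ! j) (shift T (p + q) (Hs ! l)))
        (\<lambda>t. shift_map T q (en l t p g) \<cdot> en t j q f) {..<?m}"
    proof (rule Hom.finsum_cong')
      fix t assume "t \<in> {..<?m}"
      then have t: "t < ?m" by simp
      have spB: "sp q t \<cdot> ?B \<in> Mor T (Hs ! j) (shift T q (Hs ! t))" using cmp_closed[OF B sp[OF t]] .
      have "?A \<cdot> ((si q t \<cdot> sp q t) \<cdot> ?B) = (?A \<cdot> si q t) \<cdot> (sp q t \<cdot> ?B)"
        using cmp_assoc[OF B sp[OF t] si[OF t]] cmp_assoc[OF spB si[OF t] A] by simp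
      also have "?A \<cdot> si q t = shift_map T q (en l t p g)"
        unfolding en_def si_def
        using shift_map_cmp[OF inc[OF t] cmp_closed[OF 7(4) sp[OF 7(1)]], of q] by simp
      also have "sp q t \<cdot> ?B = en t j q f"
        unfolding en_def by (rule cmp_assoc[OF inc[OF 7(2)] 7(3) sp[OF t]])
      finally show "?A \<cdot> ((si q t \<cdot> sp q t) \<cdot> ?B) = shift_map T q (en l t p g) \<cdot> en t j q f" .
    next
      show "(\<lambda>t. shift_map T q (en l t p g) \<cdot> en t j q f) \<in>
          {..<?m} \<rightarrow> Mor T (Hs ! j) (shift T (p + q) (Hs ! l))"
      proof
        fix t assume "t \<in> {..<?m}"
        then have t: "t < ?m" by simp
        show "shift_map T q (en l t p g) \<cdot> en t j q f \<in> Mor T (Hs ! j) (shift T (p + q) (Hs ! l))"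
          using cmp_closed[OF en[OF t 7(2,3)] shift_map_closed[OF en[OF 7(1) t 7(4)], of q]]
          by (simp add: shift_shift add.commute)
      qed
    qed auto
    finally have "C l j (p + q) (shift_map T q g \<cdot> f) = \<kappa> (Hs ! j) (Hs ! l) (p + q)
        (finsum (Hom T (Hs ! j) (shift T (p + q) (Hs ! l)))
          (\<lambda>t. shift_map T q (en l t p g) \<cdot> en t j q f) {..<?m})"
      by (simp add: C_def)
    also have "\<dots> = (\<Sum>t<?m. \<kappa> (Hs ! j) (Hs ! l) (p + q) (shift_map T q (en l t p g) \<cdot> en t j q f))"
    proof (rule additive_finsum)
      fix t assume "t \<in> {..<?m}"
      then have t: "t < ?m" by simp
      show "shift_map T q (en l t p g) \<cdot> en t j q f \<in> Mor T (Hs ! j) (shift T (p + q) (Hs ! l))"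
        using cmp_closed[OF en[OF t 7(2,3)] shift_map_closed[OF en[OF 7(1) t 7(4)], of q]]
        by (simp add: shift_shift add.commute)
    qed (use \<kappa>_add \<kappa>_zero 7(1,2) in auto)
    also have "\<dots> = (\<Sum>t<?m. C l t p g * C t j q f)"
    proof (rule sum.cong[OF refl])
      fix t assume "t \<in> {..<?m}"
      then have t: "t < ?m" by simp
      show "\<kappa> (Hs ! j) (Hs ! l) (p + q) (shift_map T q (en l t p g) \<cdot> en t j q f) = C l t p g * C t j q f"
        unfolding C_def
        by (rule \<kappa>_cmp[OF _ _ _ en[OF t 7(2,3)] en[OF 7(1) t 7(4)]]) (use t 7(1,2) in auto)
    qed
    finally show ?case .
  qed
  then show ?thesis by (intro exI)
qed


section \<open>The isomorphism with the matrix algebra\<close>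

lemma lookup_times_sum:
  fixes p q :: "'a :: comm_semiring_0 laurent"
  assumes "finite A" "Poly_Mapping.keys q \<subseteq> A"
  shows "Poly_Mapping.lookup (p * q) n = (\<Sum>i\<in>A. Poly_Mapping.lookup p (n - i) * Poly_Mapping.lookup q i)"
proof -
  have "Poly_Mapping.lookup (q * p) n = Sum_any (\<lambda>l. Poly_Mapping.lookup q l * Sum_any (\<lambda>r. Poly_Mapping.lookup p r when n = l + r))"
    by (rule lookup_mult)
  also have "\<dots> = Sum_any (\<lambda>l. Poly_Mapping.lookup q l * Poly_Mapping.lookup p (n - l))"
  proof (rule Sum_any.cong)
    fix l
    have "(\<lambda>r. Poly_Mapping.lookup p r when n = l + r) = (\<lambda>r. Poly_Mapping.lookup p r when n - l = r)"
      by (auto simp: when_def fun_eq_iff)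
    then show "Poly_Mapping.lookup q l * Sum_any (\<lambda>r. Poly_Mapping.lookup p r when n = l + r) = Poly_Mapping.lookup q l * Poly_Mapping.lookup p (n - l)"
      by (simp only: Sum_any_when_equal')
  qed
  also have "\<dots> = (\<Sum>i\<in>A. Poly_Mapping.lookup q i * Poly_Mapping.lookup p (n - i))"
    by (rule Sum_any.expand_superset[OF assms(1)])
      (use assms(2) in \<open>auto simp: in_keys_iff subset_eq\<close>)
  finally show ?thesis by (simp add: mult.commute)
qed

context matrix_coordinates
begin

lemma C_zero: "\<lbrakk>l < m; j < m\<rbrakk> \<Longrightarrow> C l j n \<zero>\<^bsub>Hom T G (shift T n G)\<^esub> = 0"
  using C_smult[of l j "\<zero>\<^bsub>Hom T G (shift T n G)\<^esub>" n 0] by simp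

text \<open>The set of degrees in which a family \<open>f\<close> of morphisms \<open>G \<rightarrow> G[i]\<close> is nonzero.\<close>

abbreviation supp :: "(int \<Rightarrow> 'c) \<Rightarrow> int set"
  where "supp f \<equiv> {i. f i \<noteq> \<zero>\<^bsub>Hom T G (shift T i G)\<^esub>}"

text \<open>The matrix of Laurent polynomials of a graded endomorphism.  As \<open>x\<close> has degree \<open>-1\<close>, the
  coefficient of the power of \<open>x\<close> with exponent \<open>n\<close> comes from the component of degree \<open>-n\<close>.\<close>

definition to_matrix :: "(int \<Rightarrow> 'c) \<Rightarrow> 'a laurent mat"
  where "to_matrix f = mat m m (\<lambda>(l, j). Poly_Mapping.Abs_poly_mapping (\<lambda>n. C l j (- n) (f (- n))))"

lemma to_matrix_carrier: "to_matrix f \<in> carrier_mat m m"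
  by (simp add: to_matrix_def)

lemma lookup_to_matrix:
  assumes f: "f \<in> graded_End_carrier T G" and lj: "l < m" "j < m"
  shows "Poly_Mapping.lookup (to_matrix f $$ (l, j)) n = C l j (- n) (f (- n))"
proof -
  have "finite (supp f)" using f by (simp add: graded_End_carrier_def)
  then have "finite (uminus ` supp f)" by simp
  moreover have "{n. C l j (- n) (f (- n)) \<noteq> 0} \<subseteq> uminus ` supp f"
  proof
    fix n assume "n \<in> {n. C l j (- n) (f (- n)) \<noteq> 0}"
    then have "- n \<in> supp f" using C_zero[OF lj, of "- n"] by auto
    then show "n \<in> uminus ` supp f" by force
  qed
  ultimately have "finite {n. C l j (- n) (f (- n)) \<noteq> 0}" by (rule rev_finite_subset)
  then show ?thesis using lj by (simp add: to_matrix_def)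
qed

lemma graded_EndD: "f \<in> graded_End_carrier T G \<Longrightarrow> f i \<in> Mor T G (shift T i G)"
  "f \<in> graded_End_carrier T G \<Longrightarrow> finite (supp f)"
  by (simp_all add: graded_End_carrier_def)

lemma graded_End_product_term:
  assumes "f \<in> graded_End_carrier T G" "g \<in> graded_End_carrier T G"
  shows "shift_map T i (g (n - i)) \<cdot> f i \<in> Mor T G (shift T n G)"
  using cmp_closed[OF graded_EndD(1)[OF assms(1)] shift_map_closed[OF graded_EndD(1)[OF assms(2)], of i "n - i"]]
  by (simp add: shift_shift)

lemma graded_End_mult_closed:
  assumes f: "f \<in> graded_End_carrier T G" and g: "g \<in> graded_End_carrier T G"
  shows "g \<otimes>\<^bsub>graded_End T G\<^esub> f \<in> graded_End_carrier T G"
proof -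
  let ?h = "g \<otimes>\<^bsub>graded_End T G\<^esub> f"
  have h: "?h n = finsum (Hom T G (shift T n G)) (\<lambda>i. shift_map T i (g (n - i)) \<cdot> f i) (supp f)" for n
    by (simp add: graded_End_def)
  have mor: "?h n \<in> Mor T G (shift T n G)" for n
    unfolding h by (rule Hom.finsum_closed) (use graded_End_product_term[OF f g] in auto)
  have "supp ?h \<subseteq> (\<lambda>(a, b). a + b) ` (supp g \<times> supp f)"
  proof (rule subsetI, rule ccontr)
    fix n assume n: "n \<in> supp ?h" and no: "n \<notin> (\<lambda>(a, b). a + b) ` (supp g \<times> supp f)"
    have "?h n = finsum (Hom T G (shift T n G)) (\<lambda>i. \<zero>\<^bsub>Hom T G (shift T n G)\<^esub>) (supp f)"
      unfolding h
    proof (rule Hom.finsum_cong')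
      fix i assume i: "i \<in> supp f"
      have "g (n - i) = \<zero>\<^bsub>Hom T G (shift T (n - i) G)\<^esub>"
      proof (rule ccontr)
        assume "g (n - i) \<noteq> \<zero>\<^bsub>Hom T G (shift T (n - i) G)\<^esub>"
        then have "(n - i, i) \<in> supp g \<times> supp f" using i by simp
        then have "(\<lambda>(a, b). a + b) (n - i, i) \<in> (\<lambda>(a, b). a + b) ` (supp g \<times> supp f)" by (rule imageI)
        then show False using no by simp
      qed
      then have "shift_map T i (g (n - i)) = \<zero>\<^bsub>Hom T (shift T i G) (shift T n G)\<^esub>"
        by (simp add: shift_shift)
      then show "shift_map T i (g (n - i)) \<cdot> f i = \<zero>\<^bsub>Hom T G (shift T n G)\<^esub>"
        using cmp_zero_left[OF graded_EndD(1)[OF f]] by simp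
    qed auto
    then show False using n by (simp add: Hom.finsum_zero)
  qed
  then have "finite (supp ?h)"
    using finite_subset graded_EndD(2)[OF f] graded_EndD(2)[OF g] by blast
  then show ?thesis using mor by (simp add: graded_End_carrier_def)
qed

lemma to_matrix_mult:
  assumes f: "f \<in> graded_End_carrier T G" and g: "g \<in> graded_End_carrier T G"
  shows "to_matrix (g \<otimes>\<^bsub>graded_End T G\<^esub> f) = to_matrix g * to_matrix f"
proof (rule eq_matI)
  fix l j assume "l < dim_row (to_matrix g * to_matrix f)" "j < dim_col (to_matrix g * to_matrix f)"
  then have lj: "l < m" "j < m" using to_matrix_carrier[of f] to_matrix_carrier[of g] by auto
  let ?h = "g \<otimes>\<^bsub>graded_End T G\<^esub> f"
  show "to_matrix ?h $$ (l, j) = (to_matrix g * to_matrix f) $$ (l, j)"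
  proof (rule poly_mapping_eqI)
    fix n
    have "Poly_Mapping.lookup (to_matrix ?h $$ (l, j)) n = C l j (- n)
        (finsum (Hom T G (shift T (- n) G)) (\<lambda>i. shift_map T i (g (- n - i)) \<cdot> f i) (supp f))"
      unfolding lookup_to_matrix[OF graded_End_mult_closed[OF f g] lj] by (simp add: graded_End_def)
    also have "\<dots> = (\<Sum>i\<in>supp f. C l j (- n) (shift_map T i (g (- n - i)) \<cdot> f i))"
      by (rule additive_finsum)
        (use C_add[OF lj] C_zero[OF lj] graded_EndD(2)[OF f] graded_End_product_term[OF f g] in auto)
    also have "\<dots> = (\<Sum>i\<in>supp f. \<Sum>t<m. C l t (- n - i) (g (- n - i)) * C t j i (f i))"
      using C_cmp[OF lj graded_EndD(1)[OF f] graded_EndD(1)[OF g]]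
      by (intro sum.cong refl) (metis diff_add_cancel)
    also have "\<dots> = (\<Sum>t<m. \<Sum>i\<in>supp f. C l t (- n - i) (g (- n - i)) * C t j i (f i))"
      by (rule sum.swap)
    also have "\<dots> = (\<Sum>t<m. Poly_Mapping.lookup (to_matrix g $$ (l, t) * to_matrix f $$ (t, j)) n)"
    proof (rule sum.cong[OF refl])
      fix t assume "t \<in> {..<m}"
      then have t: "t < m" by simp
      have "Poly_Mapping.keys (to_matrix f $$ (t, j)) \<subseteq> uminus ` supp f"
      proof
        fix i assume "i \<in> Poly_Mapping.keys (to_matrix f $$ (t, j))"
        then have "- i \<in> supp f"
          using lookup_to_matrix[OF f t lj(2), of i] C_zero[OF t lj(2), of "- i"] by (auto simp: in_keys_iff)
        then show "i \<in> uminus ` supp f" by force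
      qed
      then have "Poly_Mapping.lookup (to_matrix g $$ (l, t) * to_matrix f $$ (t, j)) n =
          (\<Sum>i\<in>uminus ` supp f. Poly_Mapping.lookup (to_matrix g $$ (l, t)) (n - i) * Poly_Mapping.lookup (to_matrix f $$ (t, j)) i)"
        using graded_EndD(2)[OF f] by (intro lookup_times_sum) auto
      also have "\<dots> = (\<Sum>i\<in>supp f. Poly_Mapping.lookup (to_matrix g $$ (l, t)) (n + i) * Poly_Mapping.lookup (to_matrix f $$ (t, j)) (- i))"
        by (subst sum.reindex) (auto simp: inj_on_def)
      finally show "(\<Sum>i\<in>supp f. C l t (- n - i) (g (- n - i)) * C t j i (f i)) =
          Poly_Mapping.lookup (to_matrix g $$ (l, t) * to_matrix f $$ (t, j)) n"
        using lookup_to_matrix[OF g lj(1) t] lookup_to_matrix[OF f t lj(2)] by simp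
    qed
    also have "\<dots> = Poly_Mapping.lookup ((to_matrix g * to_matrix f) $$ (l, j)) n"
      using lj to_matrix_carrier[of f] to_matrix_carrier[of g]
      by (simp add: scalar_prod_def lookup_sum atLeast0LessThan)
    finally show "Poly_Mapping.lookup (to_matrix ?h $$ (l, j)) n = Poly_Mapping.lookup ((to_matrix g * to_matrix f) $$ (l, j)) n" .
  qed
qed (simp_all add: to_matrix_def)

lemma to_matrix_eqI:
  assumes "f \<in> graded_End_carrier T G" and "A \<in> carrier_mat m m"
    and "\<And>l j n. \<lbrakk>l < m; j < m\<rbrakk> \<Longrightarrow> C l j (- n) (f (- n)) = Poly_Mapping.lookup (A $$ (l, j)) n"
  shows "to_matrix f = A"
proof (rule eq_matI)
  fix l j assume "l < dim_row A" "j < dim_col A"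
  then have "l < m" "j < m" using assms(2) by auto
  then show "to_matrix f $$ (l, j) = A $$ (l, j)"
    using lookup_to_matrix[OF assms(1)] assms(3) by (intro poly_mapping_eqI) simp
qed (use assms(2) to_matrix_carrier[of f] in auto)

lemma graded_End_iso_chi:
  assumes len: "length Hs = m"
    and entry: "\<And>l j p. \<lbrakk>l < m; j < m\<rbrakk> \<Longrightarrow>
      p \<in> chi_entry T Hs l j \<longleftrightarrow> (\<forall>n. Poly_Mapping.lookup p n \<noteq> 0 \<longrightarrow> S l j (- n))"
  shows "graded_algebra_iso (graded_End T G) (chi T Hs) to_matrix"
proof -
  have car: "carrier (graded_End T G) = graded_End_carrier T G" by (simp add: graded_End_def)
  have car': "carrier (chi T Hs) = chi_carrier T Hs" by (simp add: chi_def)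
  have carI: "A \<in> chi_carrier T Hs \<longleftrightarrow> A \<in> carrier_mat m m \<and>
      (\<forall>l<m. \<forall>j<m. \<forall>n. Poly_Mapping.lookup (A $$ (l, j)) n \<noteq> 0 \<longrightarrow> S l j (- n))" for A
    using entry by (simp add: chi_carrier_def len)
  have closed: "to_matrix f \<in> chi_carrier T Hs" if f: "f \<in> graded_End_carrier T G" for f
    unfolding carI using to_matrix_carrier lookup_to_matrix[OF f] C_support[OF _ _ graded_EndD(1)[OF f]]
    by metis
  have add: "to_matrix (f \<oplus>\<^bsub>graded_End T G\<^esub> g) = to_matrix f + to_matrix g"
    if f: "f \<in> graded_End_carrier T G" and g: "g \<in> graded_End_carrier T G" for f g
  proof (rule to_matrix_eqI)
    have "supp (\<lambda>i. f i \<oplus>\<^bsub>Hom T G (shift T i G)\<^esub> g i) \<subseteq> supp f \<union> supp g" by auto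
    then have "finite (supp (\<lambda>i. f i \<oplus>\<^bsub>Hom T G (shift T i G)\<^esub> g i))"
      using finite_subset graded_EndD(2)[OF f] graded_EndD(2)[OF g] by blast
    then show "f \<oplus>\<^bsub>graded_End T G\<^esub> g \<in> graded_End_carrier T G"
      using f g by (simp add: graded_End_def graded_End_carrier_def)
  next
    fix l j n assume "l < m" "j < m"
    then show "C l j (- n) ((f \<oplus>\<^bsub>graded_End T G\<^esub> g) (- n)) =
        Poly_Mapping.lookup ((to_matrix f + to_matrix g) $$ (l, j)) n"
      using to_matrix_carrier[of g] to_matrix_carrier[of f] lookup_to_matrix[OF f] lookup_to_matrix[OF g]
        C_add graded_EndD(1)[OF f] graded_EndD(1)[OF g]
      by (simp add: graded_End_def lookup_add)
  qed (use to_matrix_carrier in auto)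
  have smult: "to_matrix (c \<odot>\<^bsub>graded_End T G\<^esub> f) = Poly_Mapping.single 0 c \<cdot>\<^sub>m to_matrix f"
    if f: "f \<in> graded_End_carrier T G" for c f
  proof (rule to_matrix_eqI)
    have "supp (\<lambda>i. c \<odot>\<^bsub>Hom T G (shift T i G)\<^esub> f i) \<subseteq> supp f" by auto
    then have "finite (supp (\<lambda>i. c \<odot>\<^bsub>Hom T G (shift T i G)\<^esub> f i))"
      using finite_subset graded_EndD(2)[OF f] by blast
    then show "c \<odot>\<^bsub>graded_End T G\<^esub> f \<in> graded_End_carrier T G"
      using f by (simp add: graded_End_def graded_End_carrier_def)
  next
    fix l j n assume lj: "l < m" "j < m"
    have "Poly_Mapping.lookup (Poly_Mapping.single 0 c * p) n = c * Poly_Mapping.lookup p n" for p :: "'a laurent"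
      using lookup_times_sum[of "{0}" "Poly_Mapping.single 0 c" p n] by (simp add: mult.commute)
    then show "C l j (- n) ((c \<odot>\<^bsub>graded_End T G\<^esub> f) (- n)) =
        Poly_Mapping.lookup ((Poly_Mapping.single 0 c \<cdot>\<^sub>m to_matrix f) $$ (l, j)) n"
      using lj to_matrix_carrier[of f] lookup_to_matrix[OF f lj] C_smult[OF lj graded_EndD(1)[OF f]]
      by (simp add: graded_End_def)
  qed (use to_matrix_carrier in auto)
  have one: "to_matrix \<one>\<^bsub>graded_End T G\<^esub> = 1\<^sub>m m"
  proof (rule to_matrix_eqI)
    show "\<one>\<^bsub>graded_End T G\<^esub> \<in> graded_End_carrier T G"
      using ident_closed[of G] by (auto simp: graded_End_def graded_End_carrier_def shift_zero)
  next
    fix l j n assume lj: "l < m" "j < m"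
    show "C l j (- n) (\<one>\<^bsub>graded_End T G\<^esub> (- n)) = Poly_Mapping.lookup ((1\<^sub>m m :: 'a laurent mat) $$ (l, j)) n"
    proof (cases "n = 0")
      case True
      then show ?thesis using lj C_ident[OF lj] by (simp add: graded_End_def lookup_one)
    next
      case False
      then show ?thesis using lj C_zero[OF lj, of "- n"] by (simp add: graded_End_def lookup_one)
    qed
  qed auto
  have inj: "f = g" if f: "f \<in> graded_End_carrier T G" and g: "g \<in> graded_End_carrier T G"
    and eq: "to_matrix f = to_matrix g" for f g
  proof
    fix i
    let ?V = "Hom T G (shift T i G)"
    have fi: "f i \<in> Mor T G (shift T i G)" and gi: "g i \<in> Mor T G (shift T i G)"
      using f g graded_EndD(1) by blast+
    have "C l j i (f i) = C l j i (g i)" if "l < m" "j < m" for l j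
      using lookup_to_matrix[OF f that, of "- i"] lookup_to_matrix[OF g that, of "- i"] eq by simp
    then have "C l j i (f i \<oplus>\<^bsub>?V\<^esub> (- 1) \<odot>\<^bsub>?V\<^esub> g i) = 0" if "l < m" "j < m" for l j
      using that C_add[OF that fi smult_closed[OF gi]] C_smult[OF that gi] by simp
    then have "f i \<oplus>\<^bsub>?V\<^esub> (- 1) \<odot>\<^bsub>?V\<^esub> g i = \<zero>\<^bsub>?V\<^esub>" using fi gi by (intro C_faithful) auto
    moreover have "g i \<oplus>\<^bsub>?V\<^esub> (- 1) \<odot>\<^bsub>?V\<^esub> g i = \<zero>\<^bsub>?V\<^esub>"
      using smult_add_left[OF gi, of 1 "- 1"] gi by simp
    ultimately show "f i = g i"
      using fi gi smult_closed[OF gi, of "- 1"] Hom.add.right_cancel by metis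
  qed
  have surj: "\<exists>f\<in>graded_End_carrier T G. to_matrix f = A" if A: "A \<in> chi_carrier T Hs" for A
  proof -
    have "\<exists>h\<in>Mor T G (shift T i G). \<forall>l<m. \<forall>j<m. C l j i h = Poly_Mapping.lookup (A $$ (l, j)) (- i)" for i
      by (rule C_full) (use A[unfolded carI] in \<open>metis minus_minus\<close>)
    then obtain f where f: "\<And>i. f i \<in> Mor T G (shift T i G)"
      "\<And>i l j. \<lbrakk>l < m; j < m\<rbrakk> \<Longrightarrow> C l j i (f i) = Poly_Mapping.lookup (A $$ (l, j)) (- i)"
      by metis
    have "supp f \<subseteq> (\<Union>l<m. \<Union>j<m. uminus ` Poly_Mapping.keys (A $$ (l, j)))"
    proof
      fix i assume "i \<in> supp f"
      then obtain l j where lj: "l < m" "j < m" "C l j i (f i) \<noteq> 0" using C_faithful[OF f(1)] by blast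
      then have "- i \<in> Poly_Mapping.keys (A $$ (l, j))" using f(2) by (simp add: in_keys_iff)
      then have "i \<in> uminus ` Poly_Mapping.keys (A $$ (l, j))" by force
      then show "i \<in> (\<Union>l<m. \<Union>j<m. uminus ` Poly_Mapping.keys (A $$ (l, j)))" using lj by blast
    qed
    then have "finite (supp f)" by (rule finite_subset) auto
    then have fc: "f \<in> graded_End_carrier T G" using f(1) by (simp add: graded_End_carrier_def)
    then have "to_matrix f = A"
      by (rule to_matrix_eqI) (use A f(2) in \<open>auto simp: carI\<close>)
    then show ?thesis using fc by blast
  qed
  have bij: "bij_betw to_matrix (graded_End_carrier T G) (chi_carrier T Hs)"
    unfolding bij_betw_def inj_on_def using inj surj closed by blast
  have comp: "to_matrix ` component (graded_End T G) d = component (chi T Hs) d" for d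
  proof -
    have iff: "(\<forall>i. i \<noteq> d \<longrightarrow> f i = \<zero>\<^bsub>Hom T G (shift T i G)\<^esub>) \<longleftrightarrow>
        (\<forall>l<m. \<forall>j<m. Poly_Mapping.keys (to_matrix f $$ (l, j)) \<subseteq> {- d})"
      if f: "f \<in> graded_End_carrier T G" for f
    proof
      assume z: "\<forall>i. i \<noteq> d \<longrightarrow> f i = \<zero>\<^bsub>Hom T G (shift T i G)\<^esub>"
      have "n = - d" if "l < m" "j < m" "n \<in> Poly_Mapping.keys (to_matrix f $$ (l, j))" for l j n
      proof (rule ccontr)
        assume "n \<noteq> - d"
        then have "C l j (- n) (f (- n)) = 0" using z C_zero[OF that(1,2), of "- n"] by auto
        then show False using that lookup_to_matrix[OF f that(1,2), of n] by (simp add: in_keys_iff)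
      qed
      then show "\<forall>l<m. \<forall>j<m. Poly_Mapping.keys (to_matrix f $$ (l, j)) \<subseteq> {- d}" by blast
    next
      assume k: "\<forall>l<m. \<forall>j<m. Poly_Mapping.keys (to_matrix f $$ (l, j)) \<subseteq> {- d}"
      show "\<forall>i. i \<noteq> d \<longrightarrow> f i = \<zero>\<^bsub>Hom T G (shift T i G)\<^esub>"
      proof (intro allI impI C_faithful graded_EndD(1)[OF f])
        fix i l j assume "i \<noteq> d" and lj: "l < m" "j < m"
        then have "- i \<noteq> - d" by simp
        then have "- i \<notin> Poly_Mapping.keys (to_matrix f $$ (l, j))" using k lj by blast
        then show "C l j i (f i) = 0"
          using lookup_to_matrix[OF f lj, of "- i"] by (simp add: in_keys_iff)
      qed
    qed
    have A: "component (graded_End T G) d =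
        {f \<in> graded_End_carrier T G. \<forall>i. i \<noteq> d \<longrightarrow> f i = \<zero>\<^bsub>Hom T G (shift T i G)\<^esub>}"
      by (simp add: graded_End_def)
    have B: "component (chi T Hs) d = {A \<in> to_matrix ` graded_End_carrier T G.
        \<forall>l<m. \<forall>j<m. Poly_Mapping.keys (A $$ (l, j)) \<subseteq> {- d}}"
      using bij_betw_imp_surj_on[OF bij] by (simp add: chi_def len)
    show ?thesis unfolding A B using iff by blast
  qed
  have "to_matrix \<in> ring_iso (graded_End T G) (chi T Hs)"
    unfolding ring_iso_def Ring.ring_hom_def using closed to_matrix_mult add one bij
    by (auto simp: car car' chi_def len)
  then show ?thesis
    unfolding graded_algebra_iso_def using smult comp by (auto simp: car chi_def)
qed

end


section \<open>Sorting the summands\<close>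

lemma sorted_wrt_permutation_exists:
  assumes tot: "\<And>x y. \<lbrakk>x \<in> A; y \<in> A; x \<noteq> y\<rbrakk> \<Longrightarrow> R x y \<or> R y x"
    and trans: "\<And>x y z. \<lbrakk>x \<in> A; y \<in> A; z \<in> A; R x y; R y z\<rbrakk> \<Longrightarrow> R x z"
    and xs: "distinct xs" "set xs \<subseteq> A"
  shows "\<exists>ys. mset ys = mset xs \<and> sorted_wrt R ys"
  using xs
proof (induction xs)
  case Nil
  then show ?case by simp
next
  case (Cons x xs)
  then obtain ys where ys: "mset ys = mset xs" "sorted_wrt R ys" by auto
  have set: "set ys = set xs" using ys(1) by (rule mset_eq_setD)
  let ?zs = "filter (\<lambda>y. R y x) ys @ x # filter (\<lambda>y. \<not> R y x) ys"
  have "mset ?zs = mset (x # xs)" using ys(1) by (simp add: multiset_partition)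
  moreover have "sorted_wrt R ?zs"
  proof -
    have l: "y \<in> A" "y \<noteq> x" if "y \<in> set ys" for y using that set Cons.prems by auto
    have "x \<in> A" using Cons.prems by simp
    then have "R y z" if "y \<in> set ys" "R y x" "z \<in> set ys" "\<not> R z x" for y z
      using that l tot[of z x] trans[of y x z] by blast
    moreover have "R x z" if "z \<in> set ys" "\<not> R z x" for z
      using that l tot[of z x] \<open>x \<in> A\<close> by blast
    ultimately show ?thesis using ys(2) by (auto simp: sorted_wrt_append sorted_wrt_filter)
  qed
  ultimately show ?case by blast
qed

theorem proposition3p2:
  fixes T :: "('k :: alg_closed_field, 'o, 'm) tricat"
    and G :: 'o and Gs :: "'o list"
  assumes "triangulated_category T" and "hom_finite T" and "krull_schmidt T"
    and "linear_generator T G" and "minimal_generator T G"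
    and "is_direct_sum T G Gs" and "\<forall>P \<in> set Gs. indecomposable T P"
  shows "\<exists>Hs. mset Hs = mset Gs \<and> sorted_wrt (obj_less T) Hs \<and>
    (\<exists>\<phi>. graded_algebra_iso (graded_End T G) (chi T Hs) \<phi>)"
proof -
  interpret triangulated_category T by fact
  define J where "J = {P. \<exists>n :: nat. shift T (int n) P \<in> indec1 T G}"
  interpret linearly_ordered_objects T J
    unfolding J_def by (rule linear_generator_linearly_ordered_objects) fact
  have GsJ: "set Gs \<subseteq> J"
  proof
    fix P assume "P \<in> set Gs"
    then have "shift T (int 0) P \<in> indec1 T G"
      using summand_indec1[OF assms(6)] assms(7) by (simp add: shift_zero)
    then show "P \<in> J" unfolding J_def by blast
  qed
  have ni: "\<not> isomorphic T (shift T n (Gs ! j)) (Gs ! i)" if "i < length Gs" "j < length Gs" "i \<noteq> j" for i j n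
    by (rule minimal_generator_summands[OF assms(5,6) _ that]) (use assms(7) in \<open>simp add: indecomposable_def\<close>)
  have "distinct Gs"
    unfolding distinct_conv_nth using ni[of _ _ 0] isomorphic_refl by (metis shift_zero)
  have niG: "\<not> isomorphic T (shift T n P) Q" if "P \<in> set Gs" "Q \<in> set Gs" "P \<noteq> Q" for P Q n
    using that ni by (metis in_set_conv_nth)
  have niG0: "\<not> isomorphic T P Q" if "P \<in> set Gs" "Q \<in> set Gs" "P \<noteq> Q" for P Q
    using niG[OF that, of 0] by (simp add: shift_zero)
  have "\<exists>Hs. mset Hs = mset Gs \<and> sorted_wrt (obj_less T) Hs"
  proof (rule sorted_wrt_permutation_exists[of "set Gs"])
    fix P Q assume "P \<in> set Gs" "Q \<in> set Gs" "P \<noteq> Q"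
    then show "obj_less T P Q \<or> obj_less T Q P"
      using le_total niG0 GsJ unfolding obj_less_def by blast
  next
    fix P Q R assume PQR: "P \<in> set Gs" "Q \<in> set Gs" "R \<in> set Gs" and less: "obj_less T P Q" "obj_less T Q R"
    have inJ: "P \<in> J" "Q \<in> J" "R \<in> J" using PQR GsJ by auto
    have "obj_le T P R" using le_trans[OF inJ] less unfolding obj_less_def by blast
    moreover have "\<not> isomorphic T P R"
    proof
      assume "isomorphic T P R"
      then have "obj_le T Q P"
        using less(2) obj_le_isomorphic[OF _ isomorphic_refl isomorphic_sym] unfolding obj_less_def by blast
      then show False using le_antisym[OF inJ(1,2)] less(1) unfolding obj_less_def by blast
    qed
    ultimately show "obj_less T P R" unfolding obj_less_def by blast
  qed (use \<open>distinct Gs\<close> in auto)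
  then obtain Hs where Hs: "mset Hs = mset Gs" "sorted_wrt (obj_less T) Hs" by blast
  let ?m = "length Hs"
  have set: "set Hs = set Gs" using Hs(1) by (rule mset_eq_setD)
  have HsJ: "set Hs \<subseteq> J" using GsJ set by simp
  have "distinct Hs" using \<open>distinct Gs\<close> mset_eq_imp_distinct_iff[OF Hs(1)] by simp
  have sum: "is_direct_sum T G Hs" using is_direct_sum_permute assms(6) Hs(1) by blast
  have "\<exists>\<kappa>. scalar_functor T (set Hs) \<kappa>"
  proof (cases Hs)
    case Nil
    then show ?thesis by (simp add: scalar_functor_def)
  next
    case (Cons H Hs')
    have "H \<in> J" using HsJ Cons by simp
    moreover have "obj_le T H P" if "P \<in> set Hs" for P
      using that Hs(2) le_refl[OF \<open>H \<in> J\<close>] unfolding Cons by (auto simp: obj_less_def)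
    ultimately show ?thesis by (intro scalar_functor_exists[OF HsJ]) auto
  qed
  then obtain \<kappa> where "scalar_functor T (set Hs) \<kappa>" by blast
  then have "\<exists>C. matrix_coordinates T G ?m (\<lambda>l j n. obj_le T (shift T n (Hs ! l)) (Hs ! j)) C"
  proof (rule matrix_coordinates_exist[OF sum])
    fix P Q n assume "P \<in> set Hs" "Q \<in> set Hs" "\<not> obj_le T (shift T n Q) P"
    then show "Mor T P (shift T n Q) = {\<zero>\<^bsub>Hom T P (shift T n Q)\<^esub>}"
      using not_le_zero[of P "shift T n Q"] shift_closed HsJ by blast
  qed
  then obtain C where "matrix_coordinates T G ?m (\<lambda>l j n. obj_le T (shift T n (Hs ! l)) (Hs ! j)) C"
    by blast
  then interpret matrix_coordinates T G ?m "\<lambda>l j n. obj_le T (shift T n (Hs ! l)) (Hs ! j)" C .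
  have "graded_algebra_iso (graded_End T G) (chi T Hs) to_matrix"
  proof (rule graded_End_iso_chi[OF refl])
    fix l j and p :: "'k laurent" assume lj: "l < ?m" "j < ?m"
    have J: "Hs ! l \<in> J" "Hs ! j \<in> J" using lj HsJ by auto
    have ne: "Hs ! i \<noteq> Hs ! i'" if "i < ?m" "i' < ?m" "i \<noteq> i'" for i i'
      using that \<open>distinct Hs\<close> by (simp add: nth_eq_iff_index_eq)
    have niH: "\<not> isomorphic T (shift T n (Hs ! i)) (Hs ! i')" if "i < ?m" "i' < ?m" "i \<noteq> i'" for i i' n
      using niG[of "Hs ! i" "Hs ! i'" n] ne[OF that] that set by (metis nth_mem)
    have all0: "(\<forall>n. Poly_Mapping.lookup p n = 0) \<longleftrightarrow> p = 0" by (metis lookup_zero poly_mapping_eqI)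
    consider "l < j" | "l = j" | "j < l" by linarith
    then show "p \<in> chi_entry T Hs l j \<longleftrightarrow>
        (\<forall>n. Poly_Mapping.lookup p n \<noteq> 0 \<longrightarrow> obj_le T (shift T (- n) (Hs ! l)) (Hs ! j))"
    proof cases
      case 1
      then have "obj_less T (Hs ! l) (Hs ! j)" using sorted_wrt_nth_less[OF Hs(2) 1] lj by simp
      then have "obj_le T (shift T n (Hs ! l)) (Hs ! j)" for n
        using obj_less_shifts(1)[OF J] niH[OF lj] 1 by blast
      then show ?thesis using 1 by (simp add: chi_entry_def)
    next
      case 2
      show ?thesis
      proof (cases "obj_less T (Hs ! l) (shift T 1 (Hs ! l))")
        case True
        have "p \<in> polys \<longleftrightarrow> (\<forall>n. Poly_Mapping.lookup p n \<noteq> 0 \<longrightarrow> - n \<le> 0)"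
          by (auto simp: polys_def in_keys_iff subset_eq)
        then show ?thesis using 2 True shift_le_self_iff[OF J(1)] by (simp add: chi_entry_def)
      next
        case False
        then show ?thesis using 2 shift_le_self_iff[OF J(1)] by (simp add: chi_entry_def)
      qed
    next
      case 3
      then have "obj_less T (Hs ! j) (Hs ! l)" using sorted_wrt_nth_less[OF Hs(2) 3] lj by simp
      then have "\<not> obj_le T (shift T n (Hs ! l)) (Hs ! j)" for n
        using obj_less_shifts(2)[OF J(2,1)] niH[OF lj(2,1)] 3 by blast
      then show ?thesis using 3 all0 by (simp add: chi_entry_def)
    qed
  qed
  then show ?thesis using Hs by blast
qed

end
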